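(* For all integers $n\ge3$, the $\mathrm{BZ}'$-rank of $FRAC(K_n)$ is between $\left\lceil\frac n2\right\rceil-2$ and $\left\lceil\frac{n+1}2\right\rceil$ (inclusive). The same bounds hold for the $\mathrm{BZ}$-rank of $FRAC(K_n)$.
   Context: **Notation.** Let $n\ge 1$, $[n]=\{1,\dots,n\}$, $\mathcal F=\{0,1\}^n$, and let $\mathcal A=2^{\mathcal F}$ be the power set of $\mathcal F$. For $P\subseteq[0,1]^n$ let $P_I=\mathrm{conv}(P\cap\{0,1\}^n)$ and $K(P)=\{(\lambda,\lambda x)\in\mathbb R^{n+1}:\lambda\ge 0,\ x\in P\}$. For $S\subseteq[n]$, $t\in\{0,1\}$, let $S|_t=\{x\in\mathcal F: x_i=t\ \forall i\in S\}$ (so $\emptyset|_t=\mathcal F$) and $i|_t=\{i\}|_t$. For $U\subseteq[n]$ and an integer $r\ge0$ let $U|_{<r}=\{x\in\mathcal F:\sum_{i\in U}x_i\le r-1\}$. Matrices have rows and columns indexed by subfamilies of $\mathcal A$; $Ye_\alpha$ is the column of $Y$ indexed by $\alpha$. For a vector $y$ indexed by a family containing $\mathcal F$ and all $i|_1$, $\hat x(y)=(y_{\mathcal F},y_{1|_1},\dots,y_{n|_1})^\top$; for $x\in\mathbb R^n$, $\hat x=(1,x)\in\mathbb R^{n+1}$. **Input and obstructions.** The operators below take $P=\{x\in[0,1]^n:Ax\le b\}$ with $A\in\mathbb R^{m\times n}$ nonnegative and $b\in\mathbb R^m$ positive, and depend on the system $Ax\le b$. Let $A^i$ be the $i$-th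 row of $A$ and $k\ge1$. A set $O\subseteq[n]$ is a $k$-small obstruction if for some $i\in[m]$: $O\subseteq\mathrm{supp}(A^i)$, $\sum_{j\in O}A^i_j>b_i$, and ($|O|\le k+1$ or $|O|\ge|\mathrm{supp}(A^i)|-(k+1)$). Let $\mathcal O_k$ be the collection of all $k$-small obstructions and $\mathcal O_k(P)=\{x\in P:\sum_{i\in O}x_i\le|O|-1\ \forall O\in\mathcal O_k\}$. **The operator $\mathrm{BZ}'^k$ ($k\ge1$).** Walls: $\mathcal W_k=\{\bigcup_{i,j\in[\ell],i\ne j}(O_i\cap O_j):O_1,\dots,O_\ell\in\mathcal O_k,\ 2\le\ell\le k+1\}\cup\{\{1\},\dots,\{n\}\}$. Tiers: $\mathcal T_k=\{S\subseteq[n]:\exists W_1,\dots,W_k\in\mathcal W_k,\ S\subseteq\bigcup_{j=1}^kW_j\}$. Let $\mathcal A'$ consist of, for each tier $S\in\mathcal T_k$: (a) $(S\setminus T)|_1\cap T|_0$ for all $T\subseteq S$ with $|T|\le k$; (b) $(S\setminus(T\cup U))|_1\cap T|_0\cap U|_{<|U|-(k-|T|)}$ for all $T,U\subseteq S$ with $U\cap T=\emptyset$, $|T|<k$, $|U|+|T|>k$. Let $\tilde{\mathrm{BZ}}'^k(P)$ be the set of symmetric real matrices $Y$ indexed by $\mathcal A'\times\mathcal A'$ such that: (BZ'1) $Y[\mathcal F,\mathcal F]=1$. (BZ'2) Every column $y$ of $Y$ satisfies: (i) $0\le y_\alpha\le y_{\mathcal F}$ for all $\alpha\in\mathcal A'$;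 (ii) $\hat x(y)\in K(\mathcal O_k(P))$; (iii) $y_{i|_1}+y_{i|_0}=y_{\mathcal F}$ for all $i\in[n]$; (iv) for each $\alpha\in\mathcal A'$ of the form $S|_1\cap T|_0$: $y_{i|_1}\ge y_\alpha$ for $i\in S$; $y_{i|_0}\ge y_\alpha$ for $i\in T$; $y_\alpha+y_{(S\cup\{i\})|_1\cap(T\setminus\{i\})|_0}=y_{S|_1\cap(T\setminus\{i\})|_0}$ for $i\in T$; $\sum_{i\in S}y_{i|_1}+\sum_{i\in T}y_{i|_0}-y_\alpha\le(|S|+|T|-1)y_{\mathcal F}$; (v) for each $\alpha\in\mathcal A'$ of the form $S|_1\cap T|_0\cap U|_{<r}$: $y_{i|_1}\ge y_\alpha$ for $i\in S$; $y_{i|_0}\ge y_\alpha$ for $i\in T$; $\sum_{i\in U}y_{i|_0}\ge(|U|-(r-1))y_\alpha$; $y_\alpha=y_{S|_1\cap T|_0}-\sum_{U'\subseteq U,|U'|\ge r}y_{(S\cup U')|_1\cap(T\cup(U\setminus U'))|_0}$. (BZ'3) $Y[\alpha,\beta]=0$ for all $\alpha,\beta\in\mathcal A'$ with $\mathrm{conv}(\alpha)\cap\mathrm{conv}(\beta)\cap P=\emptyset$. (BZ'4) $Y[\alpha_1,\beta_1]=Y[\alpha_2,\beta_2]$ whenever $\alpha_1,\beta_1,\alpha_2,\beta_2\in\mathcal A'$ and $\alpha_1\cap\beta_1=\alpha_2\cap\beta_2$. Then $\mathrm{BZ}'^k(P)=\{x\in\mathbb R^n:\exists Y\in\tilde{\mathrm{BZ}}'^k(P),\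 \hat x(Ye_{\mathcal F})=\hat x\}$. **The operator $\mathrm{BZ}^k$ ($k\ge1$).** For $\mathrm{BZ}^k$ the walls are the sets $\bigcup_{i,j\in[\ell],i\ne j}(O_i\cap O_j)$ with $O_1,\dots,O_\ell\in\mathcal O_k$, $\ell\le k+1$ (singletons are not added), and the tiers are the unions of up to $k$ walls. Let $\mathcal B$ consist of $\mathcal F$, $i|_1$, $i|_0$ ($i\in[n]$) and the following sets: whenever $S=\bigcup_{i=1}^\ell W_i$ is a tier written as a union of $\ell\le k$ walls, for each tuple $(T_1,\dots,T_\ell)$ with $T_i\subseteq W_i$ and $\sum_{i=1}^\ell|T_i|\le k$, the set (V1) $\left(\bigcup_{i=1}^\ell W_i\setminus T_i\right)|_1\cap\left(\bigcup_{i=1}^\ell T_i\right)|_0$, and, if $\sum_{i=1}^\ell|T_i|=k$ and $T_\ell\subsetneq W_\ell$, also the set (V2) $\left(\bigcup_{i=1}^{\ell-1}W_i\setminus T_i\right)|_1\cap\left(\bigcup_{i=1}^{\ell-1}T_i\right)|_0\cap W_\ell|_{<|W_\ell|-|T_\ell|}$. (Here $\bigcup_i W_i\setminus T_i$ means $\bigcup_i(W_i\setminus T_i)$.) Let $\tilde{\mathrm{BZ}}^k(P)$ be the set of symmetric real matrices $Y$ indexed by $\mathcal B\times\mathcal B$ such that: (BZ1) $Y[\mathcal F,\mathcal F]=1$. (BZ2) Every column $x$ of $Y$ satisfies: (i) $0\le x_\alpha\le x_{\mathcal F}$ for all $\alpha\in\mathcal B$; (ii) $\hat x(x)\in K(\mathcal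 O_k(P))$; (iii) $x_{i|_1}+x_{i|_0}=x_{\mathcal F}$ for all $i$; (iv) for each $\alpha\in\mathcal B$ of the form $S|_1\cap T|_0$: $x_{i|_1}\ge x_\alpha$ for $i\in S$, $x_{i|_0}\ge x_\alpha$ for $i\in T$, $\sum_{i\in S}x_{i|_1}+\sum_{i\in T}x_{i|_0}-x_\alpha\le(|S|+|T|-1)x_{\mathcal F}$; (v) for each $\alpha\in\mathcal B$ of the form $S|_1\cap T|_0\cap U|_{<r}$: $x_{i|_1}\ge x_\alpha$ for $i\in S$, $x_{i|_0}\ge x_\alpha$ for $i\in T$, $\sum_{i\in U}x_{i|_0}\ge(|U|-(r-1))x_\alpha$; (vi) for each variable of the form (V1), writing $\gamma=\left(\bigcup_{i=1}^{\ell-1}W_i\setminus T_i\right)|_1\cap\left(\bigcup_{i=1}^{\ell-1}T_i\right)|_0$: if $|W_\ell|+\sum_{i=1}^{\ell-1}|T_i|\le k$, then $\sum_{U\subseteq W_\ell}x_{\gamma\cap(W_\ell\setminus U)|_1\cap U|_0}=x_\gamma$; otherwise, with $r=k-\sum_{i=1}^{\ell-1}|T_i|$, $\sum_{U\subseteq W_\ell,|U|\le r}x_{\gamma\cap(W_\ell\setminus U)|_1\cap U|_0}+x_{\gamma\cap W_\ell|_{<|W_\ell|-r}}=x_\gamma$. (BZ3) $Y[\alpha,\beta]=0$ for all $\alpha,\beta\in\mathcal B$ such that $\alpha\cap\beta=\emptyset$ or $\alpha\cap\beta\subseteq O|_1$ for some $O\in\mathcal O_k$. (BZ4) $Y[\alpha_1,\beta_1]=Y[\alpha_2,\beta_2]$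 whenever $\alpha_1,\beta_1,\alpha_2,\beta_2\in\mathcal B$ and $\alpha_1\cap\beta_1=\alpha_2\cap\beta_2$. Then $\mathrm{BZ}^k(P)=\{x\in\mathbb R^n:\exists Y\in\tilde{\mathrm{BZ}}^k(P),\ \hat x(Ye_{\mathcal F})=\hat x\}$. **Rank.** For an operator $\Gamma$, the $\Gamma$-rank of $P$ is the smallest integer $k\ge 0$ with $\Gamma^k(P)=P_I$, where $\Gamma^0(P)=P$. **Fractional stable set polytope.** For a graph $G=(V,E)$, $FRAC(G)=\{x\in[0,1]^V:x_i+x_j\le1\ \forall\{i,j\}\in E\}$, given by this system (one row per edge). $K_n$ is the complete graph on $n$ vertices. *)

theory Defs
  imports "HOL-Analysis.Analysis"
begin

text \<open>
  The ground set $[n]$ is a finite type \<open>'n\<close>, with $n$ its cardinality; points of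
  $R^n$ have type \<open>real ^ 'n\<close>, and points of $R^{n+1}$ have type \<open>real \<times> (real ^ 'n)\<close>, the
  first component being the homogenising coordinate.
\<close>

section \<open>Faces of the cube\<close>

definition cube01 :: "(real ^ 'n::finite) set" where
  "cube01 = {x. \<forall>i. x $ i = 0 \<or> x $ i = 1}"

definition ones :: "'n::finite set \<Rightarrow> (real ^ 'n) set" where
  "ones S = {x \<in> cube01. \<forall>i\<in>S. x $ i = 1}"

definition zeros :: "'n::finite set \<Rightarrow> (real ^ 'n) set" where
  "zeros T = {x \<in> cube01. \<forall>i\<in>T. x $ i = 0}"

definition below :: "'n::finite set \<Rightarrow> nat \<Rightarrow> (real ^ 'n) set" where
  "below U r = {x \<in> cube01. (\<Sum>i\<in>U. x $ i) \<le> real r - 1}"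

definition integer_hull :: "(real ^ 'n::finite) set \<Rightarrow> (real ^ 'n) set" where
  "integer_hull P = convex hull (P \<inter> cube01)"

definition homog_cone :: "(real ^ 'n::finite) set \<Rightarrow> (real \<times> (real ^ 'n)) set" where
  "homog_cone P = {(t, t *\<^sub>R x) | t x. 0 \<le> t \<and> x \<in> P}"

section \<open>Linear systems and small obstructions\<close>

text \<open>A system $Ax \le b$ is the set of its rows, each paired with its right-hand side.\<close>

type_synonym 'n lin_system = "((real ^ 'n) \<times> real) set"

definition polytope_of :: "'n::finite lin_system \<Rightarrow> (real ^ 'n) set" where
  "polytope_of C =
     {x. (\<forall>i. 0 \<le> x $ i \<and> x $ i \<le> 1) \<and> (\<forall>(a, b)\<in>C. a \<bullet> x \<le> b)}"

definition supp :: "real ^ 'n::finite \<Rightarrow> 'n set" where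
  "supp a = {j. a $ j \<noteq> 0}"

definition small_obstructions :: "'n::finite lin_system \<Rightarrow> nat \<Rightarrow> 'n set set" where
  "small_obstructions C k =
     {Ob. \<exists>(a, b)\<in>C. Ob \<subseteq> supp a \<and> (\<Sum>j\<in>Ob. a $ j) > b \<and>
        (card Ob \<le> k + 1 \<or> card (supp a) \<le> card Ob + (k + 1))}"

definition obstruction_relaxation :: "'n::finite lin_system \<Rightarrow> nat \<Rightarrow> (real ^ 'n) set" where
  "obstruction_relaxation C k =
     {x \<in> polytope_of C. \<forall>Ob\<in>small_obstructions C k. (\<Sum>i\<in>Ob. x $ i) \<le> real (card Ob) - 1}"

text \<open>Elements covered at least twice by a tuple, whose entries need not be distinct.\<close>

definition wall_of :: "'n set list \<Rightarrow> 'n set" where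
  "wall_of Os = \<Union>{Os ! i \<inter> Os ! j | i j. i < length Os \<and> j < length Os \<and> i \<noteq> j}"

section \<open>Matrices indexed by families of subsets of the cube\<close>

text \<open>
  A matrix is a function of two sets. Only its entries at indices in the index family of the
  operator at hand are ever constrained.
\<close>

type_synonym 'n fvector = "(real ^ 'n) set \<Rightarrow> real"
type_synonym 'n fmatrix = "(real ^ 'n) set \<Rightarrow> (real ^ 'n) set \<Rightarrow> real"

definition column :: "'n fmatrix \<Rightarrow> (real ^ 'n) set \<Rightarrow> 'n fvector" where
  "column Y \<beta> = (\<lambda>\<alpha>. Y \<alpha> \<beta>)"

definition xhat :: "'n::finite fvector \<Rightarrow> real \<times> (real ^ 'n)" where
  "xhat y = (y cube01, (\<chi> i. y (ones {i})))"

definition symmetric_on :: "(real ^ 'n) set set \<Rightarrow> 'n fmatrix \<Rightarrow> bool" where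
  "symmetric_on I Y \<longleftrightarrow> (\<forall>\<alpha>\<in>I. \<forall>\<beta>\<in>I. Y \<alpha> \<beta> = Y \<beta> \<alpha>)"

definition intersection_consistent :: "(real ^ 'n) set set \<Rightarrow> 'n fmatrix \<Rightarrow> bool" where
  "intersection_consistent I Y \<longleftrightarrow>
     (\<forall>\<alpha>1\<in>I. \<forall>\<beta>1\<in>I. \<forall>\<alpha>2\<in>I. \<forall>\<beta>2\<in>I.
        \<alpha>1 \<inter> \<beta>1 = \<alpha>2 \<inter> \<beta>2 \<longrightarrow> Y \<alpha>1 \<beta>1 = Y \<alpha>2 \<beta>2)"

section \<open>The operator BZ'\<close>

definition walls' :: "'n::finite lin_system \<Rightarrow> nat \<Rightarrow> 'n set set" where
  "walls' C k =
     {wall_of Os | Os. set Os \<subseteq> small_obstructions C k \<and> 2 \<le> length Os \<and> length Os \<le> k + 1}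
     \<union> range (\<lambda>i. {i})"

definition tiers' :: "'n::finite lin_system \<Rightarrow> nat \<Rightarrow> 'n set set" where
  "tiers' C k = {S. \<exists>Ws. length Ws = k \<and> set Ws \<subseteq> walls' C k \<and> S \<subseteq> \<Union>(set Ws)}"

definition indices' :: "'n::finite lin_system \<Rightarrow> nat \<Rightarrow> (real ^ 'n) set set" where
  "indices' C k =
     {ones (S - T) \<inter> zeros T | S T. S \<in> tiers' C k \<and> T \<subseteq> S \<and> card T \<le> k}
     \<union> {ones (S - (T \<union> U)) \<inter> zeros T \<inter> below U (card U - (k - card T)) | S T U.
          S \<in> tiers' C k \<and> T \<subseteq> S \<and> U \<subseteq> S \<and> U \<inter> T = {} \<and>
          card T < k \<and> card U + card T > k}"

text \<open>
  An index is ``of the form'' $S|_1 \cap T|_0$ if it is equal, as a set, to such an intersection.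
  In \<open>column_v'\<close> the sets $S$, $T$, $U$ are pairwise disjoint, as they are in the definition of
  \<open>indices'\<close>; this makes every set occurring in the condition an index.
\<close>

definition column_iv' :: "'n::finite lin_system \<Rightarrow> nat \<Rightarrow> 'n fvector \<Rightarrow> bool" where
  "column_iv' C k y \<longleftrightarrow>
     (\<forall>S T. ones S \<inter> zeros T \<in> indices' C k \<longrightarrow>
        (let \<alpha> = ones S \<inter> zeros T in
          (\<forall>i\<in>S. y (ones {i}) \<ge> y \<alpha>) \<and>
          (\<forall>i\<in>T. y (zeros {i}) \<ge> y \<alpha>) \<and>
          (\<forall>i\<in>T. y \<alpha> + y (ones (S \<union> {i}) \<inter> zeros (T - {i})) = y (ones S \<inter> zeros (T - {i}))) \<and>
          (\<Sum>i\<in>S. y (ones {i})) + (\<Sum>i\<in>T. y (zeros {i})) - y \<alpha>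
            \<le> (real (card S) + real (card T) - 1) * y cube01))"

definition column_v' :: "'n::finite lin_system \<Rightarrow> nat \<Rightarrow> 'n fvector \<Rightarrow> bool" where
  "column_v' C k y \<longleftrightarrow>
     (\<forall>S T U r. S \<inter> T = {} \<and> S \<inter> U = {} \<and> T \<inter> U = {} \<and>
        ones S \<inter> zeros T \<inter> below U r \<in> indices' C k \<longrightarrow>
        (let \<alpha> = ones S \<inter> zeros T \<inter> below U r in
          (\<forall>i\<in>S. y (ones {i}) \<ge> y \<alpha>) \<and>
          (\<forall>i\<in>T. y (zeros {i}) \<ge> y \<alpha>) \<and>
          (\<Sum>i\<in>U. y (zeros {i})) \<ge> (real (card U) - (real r - 1)) * y \<alpha> \<and>
          y \<alpha> = y (ones S \<inter> zeros T)
            - (\<Sum>U' | U' \<subseteq> U \<and> card U' \<ge> r. y (ones (S \<union> U') \<inter> zeros (T \<union> (U - U'))))))"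

definition valid_column' :: "'n::finite lin_system \<Rightarrow> nat \<Rightarrow> 'n fvector \<Rightarrow> bool" where
  "valid_column' C k y \<longleftrightarrow>
     (\<forall>\<alpha>\<in>indices' C k. 0 \<le> y \<alpha> \<and> y \<alpha> \<le> y cube01) \<and>
     xhat y \<in> homog_cone (obstruction_relaxation C k) \<and>
     (\<forall>i. y (ones {i}) + y (zeros {i}) = y cube01) \<and>
     column_iv' C k y \<and>
     column_v' C k y"

definition BZ'_lift :: "'n::finite lin_system \<Rightarrow> nat \<Rightarrow> 'n fmatrix set" where
  "BZ'_lift C k = {Y.
     symmetric_on (indices' C k) Y \<and>
     Y cube01 cube01 = 1 \<and>
     (\<forall>\<beta>\<in>indices' C k. valid_column' C k (column Y \<beta>)) \<and>
     (\<forall>\<alpha>\<in>indices' C k. \<forall>\<beta>\<in>indices' C k.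
        (convex hull \<alpha>) \<inter> (convex hull \<beta>) \<inter> polytope_of C = {} \<longrightarrow> Y \<alpha> \<beta> = 0) \<and>
     intersection_consistent (indices' C k) Y}"

definition BZ' :: "'n::finite lin_system \<Rightarrow> nat \<Rightarrow> (real ^ 'n) set" where
  "BZ' C k = {x. \<exists>Y\<in>BZ'_lift C k. xhat (column Y cube01) = (1, x)}"

section \<open>The operator BZ\<close>

definition walls :: "'n::finite lin_system \<Rightarrow> nat \<Rightarrow> 'n set set" where
  "walls C k =
     {wall_of Os | Os. set Os \<subseteq> small_obstructions C k \<and> 1 \<le> length Os \<and> length Os \<le> k + 1}"

text \<open>
  \<open>Ws\<close> is the list $W_1, \ldots, W_\ell$ of walls whose union is the tier, and \<open>Ts\<close> the list
  $T_1, \ldots, T_\ell$. The walls of a tuple may overlap, so \<open>tuple_face Ws Ts\<close> may be empty.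
\<close>

definition tier_tuple ::
    "'n::finite lin_system \<Rightarrow> nat \<Rightarrow> 'n set list \<Rightarrow> 'n set list \<Rightarrow> bool" where
  "tier_tuple C k Ws Ts \<longleftrightarrow>
     set Ws \<subseteq> walls C k \<and> length Ws \<le> k \<and> length Ts = length Ws \<and>
     (\<forall>i<length Ws. Ts ! i \<subseteq> Ws ! i) \<and> sum_list (map card Ts) \<le> k"

definition tuple_face :: "'n::finite set list \<Rightarrow> 'n set list \<Rightarrow> (real ^ 'n) set" where
  "tuple_face Ws Ts = ones (\<Union>i<length Ws. Ws ! i - Ts ! i) \<inter> zeros (\<Union>(set Ts))"

text \<open>
  The last two families are (V1) and (V2); in (V2) the last entries $W_\ell$, $T_\ell$ are split
  off as \<open>W\<close>, \<open>T\<close>.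
\<close>

definition indices :: "'n::finite lin_system \<Rightarrow> nat \<Rightarrow> (real ^ 'n) set set" where
  "indices C k =
     {cube01} \<union> range (\<lambda>i. ones {i}) \<union> range (\<lambda>i. zeros {i})
     \<union> {tuple_face Ws Ts | Ws Ts. tier_tuple C k Ws Ts}
     \<union> {tuple_face Ws Ts \<inter> below W (card W - card T) | Ws W Ts T.
          tier_tuple C k (Ws @ [W]) (Ts @ [T]) \<and>
          length Ts = length Ws \<and>
          sum_list (map card (Ts @ [T])) = k \<and> T \<subset> W}"

text \<open>
  Here $S$, $T$, $U$ need not be disjoint, because $W_\ell$ in (V2) may meet the other walls.
\<close>

definition column_iv :: "'n::finite lin_system \<Rightarrow> nat \<Rightarrow> 'n fvector \<Rightarrow> bool" where
  "column_iv C k x \<longleftrightarrow>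
     (\<forall>S T. ones S \<inter> zeros T \<in> indices C k \<longrightarrow>
        (let \<alpha> = ones S \<inter> zeros T in
          (\<forall>i\<in>S. x (ones {i}) \<ge> x \<alpha>) \<and>
          (\<forall>i\<in>T. x (zeros {i}) \<ge> x \<alpha>) \<and>
          (\<Sum>i\<in>S. x (ones {i})) + (\<Sum>i\<in>T. x (zeros {i})) - x \<alpha>
            \<le> (real (card S) + real (card T) - 1) * x cube01))"

definition column_v :: "'n::finite lin_system \<Rightarrow> nat \<Rightarrow> 'n fvector \<Rightarrow> bool" where
  "column_v C k x \<longleftrightarrow>
     (\<forall>S T U r. ones S \<inter> zeros T \<inter> below U r \<in> indices C k \<longrightarrow>
        (let \<alpha> = ones S \<inter> zeros T \<inter> below U r in
          (\<forall>i\<in>S. x (ones {i}) \<ge> x \<alpha>) \<and>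
          (\<forall>i\<in>T. x (zeros {i}) \<ge> x \<alpha>) \<and>
          (\<Sum>i\<in>U. x (zeros {i})) \<ge> (real (card U) - (real r - 1)) * x \<alpha>))"

definition column_vi :: "'n::finite lin_system \<Rightarrow> nat \<Rightarrow> 'n fvector \<Rightarrow> bool" where
  "column_vi C k x \<longleftrightarrow>
     (\<forall>Ws W Ts T. length Ts = length Ws \<and> tier_tuple C k (Ws @ [W]) (Ts @ [T]) \<longrightarrow>
        (let \<gamma> = tuple_face Ws Ts; s = sum_list (map card Ts) in
          if card W + s \<le> k
          then (\<Sum>U | U \<subseteq> W. x (\<gamma> \<inter> ones (W - U) \<inter> zeros U)) = x \<gamma>
          else (\<Sum>U | U \<subseteq> W \<and> card U \<le> k - s. x (\<gamma> \<inter> ones (W - U) \<inter> zeros U))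
                 + x (\<gamma> \<inter> below W (card W - (k - s))) = x \<gamma>))"

definition valid_column :: "'n::finite lin_system \<Rightarrow> nat \<Rightarrow> 'n fvector \<Rightarrow> bool" where
  "valid_column C k x \<longleftrightarrow>
     (\<forall>\<alpha>\<in>indices C k. 0 \<le> x \<alpha> \<and> x \<alpha> \<le> x cube01) \<and>
     xhat x \<in> homog_cone (obstruction_relaxation C k) \<and>
     (\<forall>i. x (ones {i}) + x (zeros {i}) = x cube01) \<and>
     column_iv C k x \<and>
     column_v C k x \<and>
     column_vi C k x"

definition BZ_lift :: "'n::finite lin_system \<Rightarrow> nat \<Rightarrow> 'n fmatrix set" where
  "BZ_lift C k = {Y.
     symmetric_on (indices C k) Y \<and>
     Y cube01 cube01 = 1 \<and>
     (\<forall>\<beta>\<in>indices C k. valid_column C k (column Y \<beta>)) \<and>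
     (\<forall>\<alpha>\<in>indices C k. \<forall>\<beta>\<in>indices C k.
        \<alpha> \<inter> \<beta> = {} \<or> (\<exists>Ob\<in>small_obstructions C k. \<alpha> \<inter> \<beta> \<subseteq> ones Ob) \<longrightarrow> Y \<alpha> \<beta> = 0) \<and>
     intersection_consistent (indices C k) Y}"

definition BZ :: "'n::finite lin_system \<Rightarrow> nat \<Rightarrow> (real ^ 'n) set" where
  "BZ C k = {x. \<exists>Y\<in>BZ_lift C k. xhat (column Y cube01) = (1, x)}"

section \<open>Rank\<close>

text \<open>
  The level-0 relaxation is $P$ itself, whatever the value of \<open>\<Gamma> 0\<close>. A relation is used
  rather than a least-number operator, so that asserting a rank also asserts its existence.
\<close>

definition level :: "(nat \<Rightarrow> (real ^ 'n) set) \<Rightarrow> (real ^ 'n) set \<Rightarrow> nat \<Rightarrow> (real ^ 'n) set" where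
  "level \<Gamma> P k = (if k = 0 then P else \<Gamma> k)"

definition has_rank :: "(nat \<Rightarrow> (real ^ 'n::finite) set) \<Rightarrow> (real ^ 'n) set \<Rightarrow> nat \<Rightarrow> bool" where
  "has_rank \<Gamma> P k \<longleftrightarrow>
     level \<Gamma> P k = integer_hull P \<and> (\<forall>j<k. level \<Gamma> P j \<noteq> integer_hull P)"

section \<open>Fractional stable set polytopes\<close>

text \<open>A graph on the vertex type \<open>'n\<close> is its set of edges, which are two-element sets.\<close>

definition FRAC :: "'n::finite set set \<Rightarrow> (real ^ 'n) set" where
  "FRAC E = {x. (\<forall>i. 0 \<le> x $ i \<and> x $ i \<le> 1) \<and> (\<forall>i j. {i, j} \<in> E \<longrightarrow> x $ i + x $ j \<le> 1)}"

definition FRAC_system :: "'n::finite set set \<Rightarrow> 'n lin_system" where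
  "FRAC_system E = {((\<chi> i. if i \<in> e then 1 else 0), 1) | e. e \<in> E}"

definition complete_edges :: "'n::finite set set" where
  "complete_edges = {{i, j} | i j. i \<noteq> j}"

lemma polytope_of_FRAC_system:
  fixes E :: "'n::finite set set"
  assumes "\<And>e. e \<in> E \<Longrightarrow> card e = 2"
  shows "polytope_of (FRAC_system E) = FRAC E"
proof -
  have inner: "(\<chi> l. if l \<in> {i, j} then 1 else 0) \<bullet> x = x $ i + x $ j"
    if "i \<noteq> j" for i j and x :: "real ^ 'n"
  proof -
    have "(\<chi> l. if l \<in> {i, j} then 1 else 0) \<bullet> x = (\<Sum>l\<in>UNIV. if l \<in> {i, j} then x $ l else 0)"
      unfolding inner_vec_def by (intro sum.cong) auto
    also have "\<dots> = (\<Sum>l\<in>{i, j}. x $ l)"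
      by (subst sum.inter_restrict[symmetric]) auto
    finally show ?thesis using that by simp
  qed
  have "(\<forall>(a, b)\<in>FRAC_system E. a \<bullet> x \<le> b) \<longleftrightarrow> (\<forall>i j. {i, j} \<in> E \<longrightarrow> x $ i + x $ j \<le> 1)"
    for x :: "real ^ 'n"
  proof
    assume L: "\<forall>(a, b)\<in>FRAC_system E. a \<bullet> x \<le> b"
    show "\<forall>i j. {i, j} \<in> E \<longrightarrow> x $ i + x $ j \<le> 1"
    proof (intro allI impI)
      fix i j assume E: "{i, j} \<in> E"
      then have "i \<noteq> j" using assms[OF E] by auto
      moreover have "(\<chi> l. if l \<in> {i, j} then 1 else 0) \<bullet> x \<le> 1"
        using L E unfolding FRAC_system_def by blast
      ultimately show "x $ i + x $ j \<le> 1" using inner by metis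
    qed
  next
    assume R: "\<forall>i j. {i, j} \<in> E \<longrightarrow> x $ i + x $ j \<le> 1"
    have "(\<chi> l. if l \<in> e then 1 else 0) \<bullet> x \<le> 1" if "e \<in> E" for e
    proof -
      obtain i j where "e = {i, j}" "i \<noteq> j" using assms[OF \<open>e \<in> E\<close>] by (auto simp: card_2_iff)
      then show ?thesis using R that inner by metis
    qed
    then show "\<forall>(a, b)\<in>FRAC_system E. a \<bullet> x \<le> b" unfolding FRAC_system_def by auto
  qed
  then show ?thesis unfolding polytope_of_def FRAC_def by simp
qed

end

theory Submission
  imports Defs
begin

text \<open>
  For $K_n$ the small obstructions are exactly the edges, at every level. Lower bound: give the
  vertex $e_i$ weight $x_i$ and the origin the possibly negative weight $1 - \sum_i x_i$; this signed
  measure $\mu$ yields the matrix $Y[\alpha,\beta] = \mu(\alpha \cap \beta)$. The equations in the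
  lifts hold for every signed measure, and the inequalities only involve the measure of sets that
  avoid the origin or miss at most $2k+4$ vertices $e_i$. Hence every $x \ge 0$ all of whose partial
  sums over $2k+4$ coordinates are at most 1 survives level $k$; this covers the integer hull, and
  also the constant vector $1/(2k+4)$, which is outside the hull when $n > 2k+4$.
  Upper bound: every column satisfies $y_{T|_0} + \sum_{i \in T} y_{i|_1} = y_F$ for $|T| \le k$;
  applied to the column of another such $T'|_0$, this gives $\sum_{i \in T \cup T'} x_i \le 1$,
  so two sets of size at most $k$ that cover $[n]$ suffice.
\<close>

section \<open>Faces of the cube\<close>

text \<open>The mass at the origin may be negative, so the measure is not monotone, and every
  comparison needs its own argument. A set containing the origin has measure 1 minus the weights of
  the vertices e_i that it misses, so an inequality becomes a count of missed vertices. The delicate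
  one is the lower bound on the sum of the \<open>zeros {i}\<close> entries over i in U, because |U|
  itself is not bounded in terms of k; at most k + 2 elements of U are spent on it. The vanishing
  rules of both lifts are harmless: the origin and the e_i lie in P, and no edge face contains any
  of them. For the upper bound, a face with two coordinates fixed to 1 lies in an edge face, so its
  entries vanish. Of the 2^|T| faces that T cuts out of the cube, only T|_0 and the |T| faces with a
  single 1 survive, and the face with its 1 at i then has the same entry as i|_1. This collapse is
  the source of the identity for y.\<close>

lemma zero_in_cube01 [simp]: "0 \<in> cube01"
  by (simp add: cube01_def)

lemma axis_in_cube01 [simp]: "axis i 1 \<in> cube01"
  by (simp add: cube01_def axis_def)

lemma ones_subset: "ones S \<subseteq> cube01"
  by (auto simp: ones_def)

lemma zeros_subset: "zeros S \<subseteq> cube01"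
  by (auto simp: zeros_def)

lemma ones_empty [simp]: "ones {} = cube01"
  by (auto simp: ones_def)

lemma zeros_empty [simp]: "zeros {} = cube01"
  by (auto simp: zeros_def)

lemma sum_cube01:
  assumes "p \<in> cube01"
  shows "(\<Sum>i\<in>U. p $ i) = real (card {i \<in> U. p $ i = 1})"
proof -
  have "(\<Sum>i\<in>U. p $ i) = (\<Sum>i\<in>U. if p $ i = 1 then 1 else 0)"
    using assms by (intro sum.cong) (auto simp: cube01_def)
  also have "\<dots> = real (card {i \<in> U. p $ i = 1})"
    by (simp add: sum.If_cases Int_def)
  finally show ?thesis .
qed

text \<open>The bound \<open>real r - 1\<close> is taken in the reals, so r = 0 gives the empty set,
  in agreement with a count below 0.\<close>

lemma below_iff: "p \<in> below U r \<longleftrightarrow> p \<in> cube01 \<and> card {i \<in> U. p $ i = 1} < r"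
proof (cases "p \<in> cube01")
  case True
  have "real m \<le> real r - 1 \<longleftrightarrow> m < r" for m
    by linarith
  then show ?thesis
    unfolding below_def mem_Collect_eq sum_cube01[OF True] using True by blast
qed (simp add: below_def)

lemma below_empty: "0 < r \<Longrightarrow> below {} r = cube01"
  by (auto simp: below_iff)

lemma zero_in_ones [simp]: "0 \<in> ones S \<longleftrightarrow> S = {}"
  by (auto simp: ones_def)

lemma zero_in_zeros [simp]: "0 \<in> zeros T"
  by (auto simp: zeros_def)

lemma zero_in_below [simp]: "0 \<in> below U r \<longleftrightarrow> 0 < r"
  by (auto simp: below_iff)

lemma axis_in_ones [simp]: "axis i 1 \<in> ones S \<longleftrightarrow> S \<subseteq> {i}"
  using axis_in_cube01[of i] by (auto simp: ones_def axis_def simp del: axis_in_cube01)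

lemma axis_in_zeros [simp]: "axis i 1 \<in> zeros T \<longleftrightarrow> i \<notin> T"
  using axis_in_cube01[of i] by (auto simp: zeros_def axis_def simp del: axis_in_cube01)

lemma axis_in_below [simp]: "axis i 1 \<in> below U r \<longleftrightarrow> (if i \<in> U then 1 else 0) < r"
proof -
  have "{j \<in> U. axis i (1::real) $ j = 1} = (if i \<in> U then {i} else {})"
    by (auto simp: axis_def)
  then show ?thesis
    by (auto simp: below_iff)
qed

text \<open>Testing a face on indicator vectors turns the equality of two representations of one
  index into an equivalence about finite sets X.\<close>

lemma indicator_in_faces:
  fixes X :: "'n::finite set"
  defines "p \<equiv> (\<chi> i. if i \<in> X then 1 else 0) :: real ^ 'n"
  shows "p \<in> ones S \<inter> zeros T \<inter> below U r \<longleftrightarrow> S \<subseteq> X \<and> X \<inter> T = {} \<and> card (X \<inter> U) < r"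
proof -
  have "{i \<in> U. p $ i = 1} = X \<inter> U"
    by (auto simp: p_def)
  then show ?thesis
    by (auto simp: ones_def zeros_def below_iff p_def cube01_def split: if_splits)
qed

text \<open>Positions of the list are counted, so an obstruction listed twice counts twice; in this
  form simp evaluates the walls of explicit lists.\<close>

lemma wall_of_iff: "x \<in> wall_of Os \<longleftrightarrow> 2 \<le> length (filter (\<lambda>A. x \<in> A) Os)"
proof -
  have "2 \<le> length (filter (\<lambda>A. x \<in> A) Os) \<longleftrightarrow> \<not> card {i. i < length Os \<and> x \<in> Os ! i} \<le> Suc 0"
    by (auto simp: length_filter_conv_card)
  also have "\<dots> \<longleftrightarrow> (\<exists>i j. i < length Os \<and> j < length Os \<and> x \<in> Os ! i \<and> x \<in> Os ! j \<and> i \<noteq> j)"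
    by (subst card_le_Suc0_iff_eq) auto
  also have "\<dots> \<longleftrightarrow> x \<in> wall_of Os"
    by (auto simp: wall_of_def)
  finally show ?thesis by simp
qed

section \<open>The complete graph\<close>

lemma polytope_complete:
  "polytope_of (FRAC_system complete_edges) = FRAC (complete_edges :: 'n::finite set set)"
  by (rule polytope_of_FRAC_system) (auto simp: complete_edges_def)

lemma FRAC_complete:
  fixes x :: "real ^ 'n::finite"
  shows "x \<in> FRAC complete_edges \<longleftrightarrow>
     (\<forall>i. 0 \<le> x $ i \<and> x $ i \<le> 1) \<and> (\<forall>i j. i \<noteq> j \<longrightarrow> x $ i + x $ j \<le> 1)"
proof -
  have "{i, j} \<in> complete_edges \<longleftrightarrow> i \<noteq> j" for i j :: 'n
    by (auto simp: complete_edges_def doubleton_eq_iff)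
  then show ?thesis
    by (auto simp: FRAC_def)
qed

text \<open>A row has two unit entries against right-hand side 1, so only its whole support violates
  it. The whole support is small for every k, since it misses none of its elements.\<close>

lemma small_obstructions_complete:
  "small_obstructions (FRAC_system complete_edges) k = (complete_edges :: 'n::finite set set)"
proof
  show "small_obstructions (FRAC_system complete_edges) k \<subseteq> (complete_edges :: 'n set set)"
  proof
    fix Ob :: "'n set"
    assume "Ob \<in> small_obstructions (FRAC_system complete_edges) k"
    then obtain i j where ij: "i \<noteq> j"
      and sub: "Ob \<subseteq> supp ((\<chi> l. if l \<in> {i, j} then 1 else 0) :: real ^ 'n)"
      and gt: "(\<Sum>l\<in>Ob. ((\<chi> l. if l \<in> {i, j} then 1 else 0) :: real ^ 'n) $ l) > 1"
      unfolding small_obstructions_def FRAC_system_def complete_edges_def by fastforce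
    have sub': "Ob \<subseteq> {i, j}"
      using sub by (auto simp: supp_def split: if_splits)
    have "(\<Sum>l\<in>Ob. ((\<chi> l. if l \<in> {i, j} then 1 else 0) :: real ^ 'n) $ l) = (\<Sum>l\<in>Ob. 1)"
      using sub' by (intro sum.cong) auto
    then have "card Ob > 1"
      using gt by simp
    then have "Ob = {i, j}"
      using sub' ij by (intro card_seteq) auto
    then show "Ob \<in> complete_edges"
      using ij by (auto simp: complete_edges_def)
  qed
  show "complete_edges \<subseteq> small_obstructions (FRAC_system (complete_edges :: 'n set set)) k"
  proof
    fix e :: "'n set"
    assume e: "e \<in> complete_edges"
    then have c: "card e = 2"
      by (auto simp: complete_edges_def)
    let ?a = "(\<chi> l. if l \<in> e then 1 else 0) :: real ^ 'n"
    have supp: "supp ?a = e"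
      by (auto simp: supp_def)
    have "(\<Sum>l\<in>e. ?a $ l) > 1"
      using c by simp
    moreover have "(?a, 1) \<in> FRAC_system complete_edges"
      using e unfolding FRAC_system_def by blast
    moreover have "card (supp ?a) \<le> card e + (k + 1)"
      by (simp add: supp)
    ultimately show "e \<in> small_obstructions (FRAC_system complete_edges) k"
      unfolding small_obstructions_def using supp by blast
  qed
qed

lemma obstruction_relaxation_complete:
  "obstruction_relaxation (FRAC_system complete_edges) k = FRAC (complete_edges :: 'n::finite set set)"
  unfolding obstruction_relaxation_def small_obstructions_complete polytope_complete
  by (auto simp: FRAC_complete) (auto simp: FRAC_complete complete_edges_def)

lemma homog_cone_complete:
  fixes z :: "real ^ 'n::finite"
  assumes "\<And>i. 0 \<le> z $ i" and "\<And>i. z $ i \<le> t" and "\<And>i j. i \<noteq> j \<Longrightarrow> z $ i + z $ j \<le> t"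
  shows "(t, z) \<in> homog_cone (FRAC complete_edges)"
proof -
  have t: "0 \<le> t"
    using assms(1,2) order_trans by blast
  \<comment> \<open>For t = 0 the bounds force z = 0, and division by zero makes the rescaled vector
    0, which lies in the polytope.\<close>
  have "z = t *\<^sub>R ((1 / t) *\<^sub>R z)"
  proof (cases "t = 0")
    case True
    then have "z = 0"
      using assms(1,2) by (auto simp: vec_eq_iff intro: antisym)
    then show ?thesis by simp
  qed simp
  moreover have "(1 / t) *\<^sub>R z \<in> FRAC complete_edges"
  proof (cases "t = 0")
    case False
    then have "0 < t" using t by simp
    then have "z $ i / t \<le> 1" "0 \<le> z $ i / t" for i
      using assms(1,2) by simp_all
    moreover have "z $ i / t + z $ j / t \<le> 1" if "i \<noteq> j" for i j
      using assms(3)[OF that] \<open>0 < t\<close> by (simp add: field_simps)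
    ultimately show ?thesis
      by (simp add: FRAC_complete)
  qed (simp add: FRAC_complete)
  ultimately show ?thesis
    unfolding homog_cone_def using t by blast
qed

lemma cube_in_FRAC_complete:
  shows "0 \<in> FRAC complete_edges" and "axis i 1 \<in> FRAC complete_edges"
  by (auto simp: FRAC_complete axis_def)

text \<open>The stable sets of the complete graph are the empty set and the singletons, so the hull
  is the standard simplex.\<close>

lemma integer_hull_complete:
  "integer_hull (FRAC (complete_edges :: 'n::finite set set)) =
     {x. (\<forall>i. 0 \<le> x $ i) \<and> (\<Sum>i\<in>UNIV. x $ i) \<le> 1}"
proof -
  have "FRAC complete_edges \<inter> cube01 = insert 0 (Basis :: (real ^ 'n) set)"
  proof
    show "FRAC complete_edges \<inter> cube01 \<subseteq> insert 0 (Basis :: (real ^ 'n) set)"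
    proof
      fix p :: "real ^ 'n"
      assume p: "p \<in> FRAC complete_edges \<inter> cube01"
      show "p \<in> insert 0 Basis"
      proof (cases "\<exists>i. p $ i = 1")
        case True
        then obtain i where i: "p $ i = 1" by blast
        have "p $ j = 0" if "j \<noteq> i" for j
        proof -
          have "p $ j + p $ i \<le> 1" "0 \<le> p $ j"
            using p that by (auto simp: FRAC_complete)
          then show ?thesis using i by simp
        qed
        then have "p = axis i 1"
          using i by (auto simp: vec_eq_iff axis_def)
        then show ?thesis
          by (auto simp: Basis_vec_def)
      next
        case False
        then have "p = 0"
          using p by (auto simp: vec_eq_iff cube01_def)
        then show ?thesis by simp
      qed
    qed
    show "insert 0 (Basis :: (real ^ 'n) set) \<subseteq> FRAC complete_edges \<inter> cube01"
      by (auto simp: cube_in_FRAC_complete Basis_vec_def)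
  qed
  moreover have "(\<Sum>b\<in>Basis. x \<bullet> b) = (\<Sum>i\<in>UNIV. x $ i)" for x :: "real ^ 'n"
  proof -
    have "(Basis :: (real ^ 'n) set) = range (\<lambda>i. axis i 1)"
      by (auto simp: Basis_vec_def)
    moreover have "inj (\<lambda>i::'n. axis i (1::real))"
      by (auto simp: inj_def axis_eq_axis)
    ultimately have "(\<Sum>b\<in>Basis. x \<bullet> b) = (\<Sum>i\<in>UNIV. x \<bullet> axis i 1)"
      using sum.reindex[of "\<lambda>i::'n. axis i (1::real)" UNIV "\<lambda>b. x \<bullet> b"] by (simp add: o_def)
    then show ?thesis
      by (simp add: inner_axis)
  qed
  moreover have "(\<forall>b\<in>Basis. 0 \<le> x \<bullet> b) \<longleftrightarrow> (\<forall>i. 0 \<le> x $ i)" for x :: "real ^ 'n"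
    by (auto simp: Basis_vec_def inner_axis)
  ultimately show ?thesis
    unfolding integer_hull_def by (simp add: std_simplex)
qed

section \<open>Signed measures on the stable sets\<close>

text \<open>Masses x_i at the vertices and total mass 1 are what makes the column of
  \<open>cube01\<close> return \<open>(1, x)\<close>; they determine the mass at the origin.\<close>

definition vmeasure :: "real ^ 'n::finite \<Rightarrow> (real ^ 'n) set \<Rightarrow> real" where
  "vmeasure x A =
     (1 - (\<Sum>i\<in>UNIV. x $ i)) * indicator A 0 + (\<Sum>i\<in>UNIV. x $ i * indicator A (axis i 1))"

lemma vmeasure_empty [simp]: "vmeasure x {} = 0"
  by (simp add: vmeasure_def)

lemma vmeasure_Un:
  assumes "A \<inter> B = {}"
  shows "vmeasure x (A \<union> B) = vmeasure x A + vmeasure x B"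
  using assms
  by (simp add: vmeasure_def indicator_add[symmetric] sum.distrib algebra_simps)

lemma vmeasure_UN:
  assumes "finite J" and "\<And>i j. i \<in> J \<Longrightarrow> j \<in> J \<Longrightarrow> i \<noteq> j \<Longrightarrow> B i \<inter> B j = {}"
  shows "vmeasure x (\<Union>j\<in>J. B j) = (\<Sum>j\<in>J. vmeasure x (B j))"
  using assms
proof (induction J rule: finite_induct)
  case (insert j J)
  have "B j \<inter> (\<Union>i\<in>J. B i) = {}"
    using insert by fastforce
  then show ?case
    using insert by (simp add: vmeasure_Un)
qed simp

lemma vmeasure_Diff:
  assumes "A \<subseteq> B"
  shows "vmeasure x (B - A) = vmeasure x B - vmeasure x A"
proof -
  have "vmeasure x (A \<union> (B - A)) = vmeasure x A + vmeasure x (B - A)"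
    by (rule vmeasure_Un) auto
  then show ?thesis
    using assms by (simp add: Un_absorb1)
qed

lemma vmeasure_without_0:
  assumes "0 \<notin> A"
  shows "vmeasure x A = (\<Sum>i | axis i 1 \<in> A. x $ i)"
  using assms by (simp add: vmeasure_def indicator_def if_distrib sum.If_cases cong: if_cong)

text \<open>The total mass is 1, so passing to the complement trades the mass at the origin for the
  missed vertices. Nonnegativity thereby becomes an upper bound on a partial sum of
  \<open>x\<close>.\<close>

lemma vmeasure_with_0:
  assumes "0 \<in> A"
  shows "vmeasure x A = 1 - (\<Sum>i | axis i 1 \<notin> A. x $ i)"
proof -
  have "vmeasure x (- A) = vmeasure x UNIV - vmeasure x A"
    by (simp add: Compl_eq_Diff_UNIV vmeasure_Diff)
  moreover have "vmeasure x UNIV = 1"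
    by (simp add: vmeasure_def)
  ultimately show ?thesis
    using assms vmeasure_without_0[of "- A" x] by simp
qed

lemma vmeasure_eq_0:
  assumes "0 \<notin> A" and "\<And>i. axis i 1 \<notin> A"
  shows "vmeasure x A = 0"
  using assms by (simp add: vmeasure_without_0)

lemma vmeasure_vertex:
  "vmeasure x (ones {i} \<inter> A) = (if axis i 1 \<in> A then x $ i else 0)"
proof -
  have "{j. axis j 1 \<in> ones {i} \<inter> A} = (if axis i 1 \<in> A then {i} else {})"
    by auto
  then show ?thesis
    by (simp add: vmeasure_without_0)
qed

text \<open>A cube point lies in exactly one of these faces, the one whose U is its zero set in W.
  The sum in \<open>column_v'\<close> and both sums in \<open>column_vi\<close> are instances, with
  \<open>Q\<close> selecting the admissible sizes.\<close>

lemma vmeasure_partition: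
  assumes "A \<subseteq> cube01"
  shows "(\<Sum>U | U \<subseteq> W \<and> Q U. vmeasure x (A \<inter> ones (W - U) \<inter> zeros U \<inter> B)) =
    vmeasure x {p \<in> A \<inter> B. Q {i \<in> W. p $ i = 0}}"
proof -
  have eq: "U = {i \<in> W. p $ i = 0}" if "U \<subseteq> W" "p \<in> ones (W - U)" "p \<in> zeros U" for U and p :: "real ^ 'a"
  proof -
    have "p $ i = 1" if "i \<in> W - U" for i
      using that \<open>p \<in> ones (W - U)\<close> by (auto simp: ones_def)
    moreover have "p $ i = 0" if "i \<in> U" for i
      using that \<open>p \<in> zeros U\<close> by (auto simp: zeros_def)
    ultimately show ?thesis
      using \<open>U \<subseteq> W\<close> by force
  qed
  have "(\<Sum>U | U \<subseteq> W \<and> Q U. vmeasure x (A \<inter> ones (W - U) \<inter> zeros U \<inter> B)) =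
    vmeasure x (\<Union>U\<in>{U. U \<subseteq> W \<and> Q U}. A \<inter> ones (W - U) \<inter> zeros U \<inter> B)"
    by (rule vmeasure_UN[symmetric]) (simp, use eq in blast)
  also have "(\<Union>U\<in>{U. U \<subseteq> W \<and> Q U}. A \<inter> ones (W - U) \<inter> zeros U \<inter> B) =
      {p \<in> A \<inter> B. Q {i \<in> W. p $ i = 0}}" (is "?L = ?R")
  proof
    show "?L \<subseteq> ?R"
      using eq by blast
    show "?R \<subseteq> ?L"
    proof
      fix p assume p: "p \<in> ?R"
      then have "p \<in> cube01"
        using assms by auto
      then have "p \<in> ones (W - {i \<in> W. p $ i = 0})" "p \<in> zeros {i \<in> W. p $ i = 0}"
        by (auto simp: ones_def zeros_def cube01_def)
      then show "p \<in> ?L"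
        using p by (intro UN_I[of "{i \<in> W. p $ i = 0}"]) auto
    qed
  qed
  finally show ?thesis .
qed

text \<open>The common shape of all indices of both operators; $U = \emptyset$, $r = 1$ gives $S|_1 \cap T|_0$.\<close>

definition small_face :: "nat \<Rightarrow> (real ^ 'n::finite) set \<Rightarrow> bool" where
  "small_face k \<alpha> \<longleftrightarrow> (\<exists>S T U r. \<alpha> = ones S \<inter> zeros T \<inter> below U r \<and>
     card T \<le> k \<and> card U + card T \<le> k + r \<and> 0 < r)"

lemma small_face_subset: "small_face k \<alpha> \<Longrightarrow> \<alpha> \<subseteq> cube01"
  using ones_subset by (auto simp: small_face_def)

lemma small_faceI:
  assumes "card T \<le> k"
  shows "small_face k (ones S \<inter> zeros T)"
proof -
  have "ones S \<inter> zeros T = ones S \<inter> zeros T \<inter> below {} 1"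
    using ones_subset[of S] by (auto simp: below_empty)
  then show ?thesis
    unfolding small_face_def using assms by (intro exI[of _ S] exI[of _ T] exI[of _ "{}"] exI[of _ 1]) simp
qed

text \<open>Containing the origin forces S to be empty. For r at least 2 the face misses only the
  vertices of T; for r = 1 it also misses those of U, but then |U| + |T| is at most k + 1.\<close>

lemma small_face_missing:
  assumes "small_face k \<beta>" and "0 \<in> \<beta>"
  shows "card {i. axis i 1 \<notin> \<beta>} \<le> k + 1"
proof -
  obtain S T U r where b: "\<beta> = ones S \<inter> zeros T \<inter> below U r"
    and c: "card T \<le> k" "card U + card T \<le> k + r" "0 < r"
    using assms(1) by (auto simp: small_face_def)
  have S: "S = {}"
    using assms(2) b by simp
  show ?thesis
  proof (cases "r = 1")
    case True
    have "{i. axis i 1 \<notin> \<beta>} \<subseteq> T \<union> U"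
      using True by (auto simp: b S)
    then have "card {i. axis i 1 \<notin> \<beta>} \<le> card (T \<union> U)"
      by (intro card_mono) auto
    also have "\<dots> \<le> card T + card U"
      by (rule card_Un_le)
    finally show ?thesis
      using c True by simp
  next
    case False
    have "{i. axis i 1 \<notin> \<beta>} \<subseteq> T"
      using False c(3) by (auto simp: b S split: if_splits)
    then have "card {i. axis i 1 \<notin> \<beta>} \<le> card T"
      by (intro card_mono) auto
    then show ?thesis
      using c by simp
  qed
qed

text \<open>
  Needed because the column conditions range over all representations of an index, not only over
  the one that makes it an index. The argument determines $r$, and up to inclusion $U$, from the
  set alone: remove single elements from the minimal sets violating the bound.
\<close>

lemma small_face_below_bound:
  fixes T U :: "'n::finite set"
  assumes "small_face k (zeros T \<inter> below U r)" and "U \<inter> T = {}" and "2 \<le> r" and "r \<le> card U"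
  shows "card U \<le> k + r"
proof -
  obtain S' T' U' r' where eq: "zeros T \<inter> below U r = ones S' \<inter> zeros T' \<inter> below U' r'"
    and c: "card U' + card T' \<le> k + r'"
    using assms(1) by (auto simp: small_face_def)
  have "0 \<in> ones S' \<inter> zeros T' \<inter> below U' r'"
    using assms(3) by (simp flip: eq)
  then have S': "S' = {}"
    by simp
  \<comment> \<open>Both representations are compared on the indicator vector of X.\<close>
  have iff: "X \<inter> T = {} \<and> card (X \<inter> U) < r \<longleftrightarrow> X \<inter> T' = {} \<and> card (X \<inter> U') < r'" for X
  proof -
    have "zeros T \<inter> below U r = ones {} \<inter> zeros T \<inter> below U r"
      using zeros_subset[of T] by auto
    then show ?thesis
      using eq S' indicator_in_faces[of X "{}" T U r] indicator_in_faces[of X "{}" T' U' r'] by simp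
  qed
  \<comment> \<open>As r is at least 2, a singleton inside U satisfies the first description, hence
    the second, so it avoids T'.\<close>
  have T': "i \<notin> T'" if "i \<in> U" for i
  proof -
    have "card ({i} \<inter> U) \<le> card {i}"
      by (intro card_mono) auto
    then show ?thesis
      using iff[of "{i}"] that assms(2,3) by auto
  qed
  have X: "X \<subseteq> U' \<and> card X = r'" if X: "X \<subseteq> U" "card X = r" for X
  proof -
    have "X \<inter> U = X" "X \<inter> T = {}" "X \<inter> T' = {}"
      using X assms(2) T' by auto
    then have ge: "r' \<le> card (X \<inter> U')"
      using iff[of X] X(2) by auto
    have "i \<in> U' \<and> card (X \<inter> U') \<le> r'" if "i \<in> X" for i
    proof -
      have "(X - {i}) \<inter> U = X - {i}" "(X - {i}) \<inter> T = {}"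
        using X assms(2) by auto
      moreover have "card (X - {i}) < r"
        using X(2) that assms(3) by simp
      ultimately have "card ((X - {i}) \<inter> U') < r'"
        using iff[of "X - {i}"] by auto
      moreover have "(X - {i}) \<inter> U' = X \<inter> U' - {i}"
        by auto
      ultimately have lt: "card (X \<inter> U' - {i}) < r'"
        by simp
      then have "i \<in> U'"
        using ge by (cases "i \<in> U'") auto
      then show ?thesis
        using lt that by auto
    qed
    moreover have "X \<noteq> {}"
      using X(2) assms(3) by auto
    ultimately have "X \<subseteq> U'" "card (X \<inter> U') \<le> r'"
      by auto
    then show ?thesis
      using ge by (simp add: Int_absorb2)
  qed
  \<comment> \<open>The r-subsets of U cover U because r is at most |U|; as each lies in U', so does
    U.\<close>
  have ex: "\<exists>X \<subseteq> U. card X = r \<and> u \<in> X" if "u \<in> U" for u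
  proof -
    have "r - 1 \<le> card (U - {u})"
      using that assms(4) by simp
    then obtain Z where "Z \<subseteq> U - {u}" "card Z = r - 1"
      by (meson obtain_subset_with_card_n)
    then show ?thesis
      using that assms(3) by (intro exI[of _ "insert u Z"]) (auto simp: card_insert_if)
  qed
  have "U \<subseteq> U'"
    using ex X by blast
  then have "card U \<le> card U'"
    by (intro card_mono) auto
  moreover have "r' = r"
  proof -
    obtain Z where "Z \<subseteq> U" "card Z = r"
      using assms(4) by (meson obtain_subset_with_card_n)
    then show ?thesis
      using X by auto
  qed
  ultimately show ?thesis
    using c by simp
qed

text \<open>These are the sets that are cheap to subtract from a larger one: if the origin is in the
  set, the difference avoids it and has nonnegative measure for nonnegative weights; otherwise the
  difference loses at most one vertex.\<close>

definition thin :: "(real ^ 'n::finite) set \<Rightarrow> bool" where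
  "thin \<alpha> \<longleftrightarrow> 0 \<in> \<alpha> \<or> (\<exists>j. \<forall>i. axis i 1 \<in> \<alpha> \<longrightarrow> i = j)"

lemma thin_face: "thin (ones S \<inter> zeros T \<inter> below U r)"
  by (cases "S = {}"; cases "r = 0") (auto simp: thin_def)

lemma thin_small_face: "small_face k \<alpha> \<Longrightarrow> thin \<alpha>"
  by (auto simp: small_face_def thin_face)

section \<open>Indices of both operators as small faces\<close>

lemma indices'_small_face:
  assumes "\<alpha> \<in> indices' C k"
  shows "small_face k \<alpha>"
proof -
  consider (a) S T where "\<alpha> = ones (S - T) \<inter> zeros T" "card T \<le> k"
    | (b) S T U where "\<alpha> = ones (S - (T \<union> U)) \<inter> zeros T \<inter> below U (card U - (k - card T))"
        "card T < k" "card U + card T > k"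
    using assms unfolding indices'_def by blast
  then show ?thesis
  proof cases
    case a
    then show ?thesis
      by (simp add: small_faceI)
  next
    case b
    then show ?thesis
      unfolding small_face_def
      by (intro exI[of _ "S - (T \<union> U)"] exI[of _ T] exI[of _ U] exI[of _ "card U - (k - card T)"]) auto
  qed
qed

lemma card_Union_list_le: "card (\<Union>(set Ts)) \<le> sum_list (map card Ts)"
proof (induction Ts)
  case (Cons A Ts)
  have "card (A \<union> \<Union>(set Ts)) \<le> card A + card (\<Union>(set Ts))"
    by (rule card_Un_le)
  then show ?case
    using Cons by simp
qed simp

text \<open>In (V2) the bound is r = |W| - |T|, and all the T_i together have size k, so |W| plus
  the sizes of the other T_i is k + r. Overlaps among the T_i only shrink their union. The level
  must be positive for \<open>zeros {i}\<close>.\<close>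

lemma indices_small_face:
  fixes C :: "'n::finite lin_system"
  assumes "1 \<le> k" and "\<alpha> \<in> indices C k"
  shows "small_face k \<alpha>"
proof -
  consider (cube) "\<alpha> = cube01" | (one) i where "\<alpha> = ones {i}" | (zero) i where "\<alpha> = zeros {i}"
    | (V1) Ws Ts where "\<alpha> = tuple_face Ws Ts" "tier_tuple C k Ws Ts"
    | (V2) Ws W Ts T where "\<alpha> = tuple_face Ws Ts \<inter> below W (card W - card T)"
        "sum_list (map card (Ts @ [T])) = k" "T \<subset> W"
    using assms(2) unfolding indices_def by blast
  then show ?thesis
  proof cases
    case cube
    then show ?thesis
      using small_faceI[of "{}" k "{} :: 'n set"] by simp
  next
    case one
    then have "\<alpha> = ones {i} \<inter> zeros {}"
      using ones_subset[of "{i}"] by auto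
    then show ?thesis
      by (simp only: small_faceI card.empty le0)
  next
    case zero
    then have "\<alpha> = ones {} \<inter> zeros {i}"
      using zeros_subset[of "{i}"] by auto
    then show ?thesis
      using assms(1) by (simp only:) (rule small_faceI, simp)
  next
    case V1
    then have "card (\<Union>(set Ts)) \<le> k"
      using card_Union_list_le[of Ts] by (simp add: tier_tuple_def)
    then show ?thesis
      unfolding V1(1) tuple_face_def by (rule small_faceI)
  next
    case V2
    have "card T < card W"
      using V2(3) by (simp add: psubset_card_mono)
    then show ?thesis
      unfolding V2(1) tuple_face_def small_face_def
      using card_Union_list_le[of Ts] V2(2) by (intro exI conjI) (rule refl, auto)
  qed
qed

text \<open>The number 2k + 4 is the largest n with \<lceil>n/2\<rceil> - 2 \<le> k. It accommodates
  the costliest count below: k + 1 vertices missed by an index together with k + 2 further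
  vertices.\<close>

locale light_weight =
  fixes x :: "real ^ 'n::finite" and k :: nat
  assumes nonneg: "\<And>i. 0 \<le> x $ i"
    and light: "\<And>M. card M \<le> 2 * k + 4 \<Longrightarrow> (\<Sum>i\<in>M. x $ i) \<le> 1"
begin

section \<open>Inequalities of the signed measure for light weights\<close>

lemma vmeasure_nonneg:
  assumes "0 \<in> A \<Longrightarrow> card {i. axis i 1 \<notin> A} \<le> 2 * k + 4"
  shows "0 \<le> vmeasure x A"
proof (cases "0 \<in> A")
  case True
  then show ?thesis
    using light[of "{i. axis i 1 \<notin> A}"] assms by (simp add: vmeasure_with_0)
next
  case False
  then show ?thesis
    by (simp add: vmeasure_without_0 sum_nonneg nonneg)
qed

text \<open>If the difference of the two intersections contains the origin, then A does not, and
  thinness lets A remove at most one vertex. B misses at most one more and \<beta> at most k +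
  1.\<close>

lemma vmeasure_mono:
  assumes "A \<subseteq> B" and "thin A" and "small_face k \<beta>" and "0 \<in> B \<Longrightarrow> card {i. axis i 1 \<notin> B} \<le> 1"
  shows "vmeasure x (A \<inter> \<beta>) \<le> vmeasure x (B \<inter> \<beta>)"
proof -
  have "0 \<le> vmeasure x (B \<inter> \<beta> - A \<inter> \<beta>)"
  proof (rule vmeasure_nonneg)
    assume 0: "0 \<in> B \<inter> \<beta> - A \<inter> \<beta>"
    then obtain j where j: "\<forall>i. axis i 1 \<in> A \<longrightarrow> i = j"
      using assms(2) by (auto simp: thin_def)
    have "{i. axis i 1 \<notin> B \<inter> \<beta> - A \<inter> \<beta>} \<subseteq> {i. axis i 1 \<notin> B} \<union> {i. axis i 1 \<notin> \<beta>} \<union> {j}"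
      using j by auto
    then have "card {i. axis i 1 \<notin> B \<inter> \<beta> - A \<inter> \<beta>} \<le>
        card ({i. axis i 1 \<notin> B} \<union> {i. axis i 1 \<notin> \<beta>} \<union> {j})"
      by (intro card_mono) auto
    also have "\<dots> \<le> card {i. axis i 1 \<notin> B} + card {i. axis i 1 \<notin> \<beta>} + card {j}"
      by (meson add_right_mono card_Un_le order_trans)
    also have "\<dots> \<le> 1 + (k + 1) + 1"
      using 0 assms(4) small_face_missing[OF assms(3)] by simp
    finally show "card {i. axis i 1 \<notin> B \<inter> \<beta> - A \<inter> \<beta>} \<le> 2 * k + 4"
      by simp
  qed
  moreover have "A \<inter> \<beta> \<subseteq> B \<inter> \<beta>"
    using assms(1) by auto
  ultimately show ?thesis
    using vmeasure_Diff[of "A \<inter> \<beta>" "B \<inter> \<beta>" x] by simp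
qed

lemma vmeasure_small_faces:
  assumes "small_face k \<alpha>" and "small_face k \<beta>"
  shows "0 \<le> vmeasure x (\<alpha> \<inter> \<beta>)"
proof (rule vmeasure_nonneg)
  assume 0: "0 \<in> \<alpha> \<inter> \<beta>"
  have "{i. axis i 1 \<notin> \<alpha> \<inter> \<beta>} = {i. axis i 1 \<notin> \<alpha>} \<union> {i. axis i 1 \<notin> \<beta>}"
    by auto
  then have "card {i. axis i 1 \<notin> \<alpha> \<inter> \<beta>} \<le> card {i. axis i 1 \<notin> \<alpha>} + card {i. axis i 1 \<notin> \<beta>}"
    by (simp add: card_Un_le)
  then show "card {i. axis i 1 \<notin> \<alpha> \<inter> \<beta>} \<le> 2 * k + 4"
    using 0 small_face_missing[OF assms(1)] small_face_missing[OF assms(2)] by simp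
qed

text \<open>Together, U and the vertices missed by \<beta> number at most (k + 2) + (k + 1). Pairs U
  give the edge constraints on a column; sizes up to k + 2 are needed for the bound on
  \<open>below\<close>.\<close>

lemma vmeasure_vertices:
  assumes "small_face k \<beta>" and "card U \<le> k + 2"
  shows "(\<Sum>i\<in>U. vmeasure x (ones {i} \<inter> \<beta>)) \<le> vmeasure x \<beta>"
proof -
  have eq: "(\<Sum>i\<in>U. vmeasure x (ones {i} \<inter> \<beta>)) = (\<Sum>i\<in>{i \<in> U. axis i 1 \<in> \<beta>}. x $ i)"
    by (simp add: vmeasure_vertex sum.inter_filter)
  show ?thesis
  proof (cases "0 \<in> \<beta>")
    case False
    have "(\<Sum>i\<in>{i \<in> U. axis i 1 \<in> \<beta>}. x $ i) \<le> (\<Sum>i | axis i 1 \<in> \<beta>. x $ i)"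
      by (intro sum_mono2) (auto simp: nonneg)
    then show ?thesis
      using eq False by (simp add: vmeasure_without_0)
  next
    case True
    let ?U = "{i \<in> U. axis i 1 \<in> \<beta>}" and ?M = "{i. axis i 1 \<notin> \<beta>}"
    have "card ?U \<le> card U"
      by (intro card_mono) auto
    then have "card (?U \<union> ?M) \<le> 2 * k + 4"
      using card_Un_le[of ?U ?M] assms(2) small_face_missing[OF assms(1) True] by simp
    then have "(\<Sum>i\<in>?U \<union> ?M. x $ i) \<le> 1"
      by (rule light)
    moreover have "(\<Sum>i\<in>?U \<union> ?M. x $ i) = (\<Sum>i\<in>?U. x $ i) + (\<Sum>i\<in>?M. x $ i)"
      by (intro sum.union_disjoint) auto
    ultimately show ?thesis
      using eq True by (simp add: vmeasure_with_0)
  qed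
qed

lemma vmeasure_ones_zeros:
  assumes "\<beta> \<subseteq> cube01"
  shows "vmeasure x (ones {i} \<inter> \<beta>) + vmeasure x (zeros {i} \<inter> \<beta>) = vmeasure x \<beta>"
proof -
  have "\<beta> = (ones {i} \<inter> \<beta>) \<union> (zeros {i} \<inter> \<beta>)"
    using assms by (auto simp: ones_def zeros_def cube01_def)
  moreover have "(ones {i} \<inter> \<beta>) \<inter> (zeros {i} \<inter> \<beta>) = {}"
    by (auto simp: ones_def zeros_def)
  ultimately show ?thesis
    by (metis vmeasure_Un)
qed

lemma vmeasure_vertex_nonneg: "0 \<le> vmeasure x (ones {i} \<inter> \<beta>)"
  by (simp add: vmeasure_vertex nonneg)

lemma vmeasure_le_ones:
  assumes "small_face k \<beta>" and "thin \<alpha>" and "\<alpha> \<subseteq> ones {i}"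
  shows "vmeasure x (\<alpha> \<inter> \<beta>) \<le> vmeasure x (ones {i} \<inter> \<beta>)"
  using assms by (intro vmeasure_mono) auto

lemma vmeasure_le_zeros:
  assumes "small_face k \<beta>" and "thin \<alpha>" and "\<alpha> \<subseteq> zeros {i}"
  shows "vmeasure x (\<alpha> \<inter> \<beta>) \<le> vmeasure x (zeros {i} \<inter> \<beta>)"
  using assms by (intro vmeasure_mono) auto

lemma vmeasure_le_whole:
  assumes "small_face k \<beta>" and "thin \<alpha>"
  shows "vmeasure x (\<alpha> \<inter> \<beta>) \<le> vmeasure x \<beta>"
  using vmeasure_mono[of \<alpha> UNIV \<beta>] assms by simp

lemma vmeasure_zeros_bounds:
  assumes "small_face k \<beta>"
  shows "0 \<le> vmeasure x (zeros {i} \<inter> \<beta>)" and "vmeasure x (zeros {i} \<inter> \<beta>) \<le> vmeasure x \<beta>"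
    and "j \<noteq> i \<Longrightarrow> vmeasure x (ones {j} \<inter> \<beta>) \<le> vmeasure x (zeros {i} \<inter> \<beta>)"
proof -
  note oz = vmeasure_ones_zeros[OF small_face_subset[OF assms], of i]
  show "0 \<le> vmeasure x (zeros {i} \<inter> \<beta>)"
    using oz vmeasure_vertices[OF assms, of "{i}"] by simp
  show "vmeasure x (zeros {i} \<inter> \<beta>) \<le> vmeasure x \<beta>"
    using oz vmeasure_vertex_nonneg[of i \<beta>] by simp
  show "vmeasure x (ones {j} \<inter> \<beta>) \<le> vmeasure x (zeros {i} \<inter> \<beta>)" if "j \<noteq> i"
    using oz vmeasure_vertices[OF assms, of "{i, j}"] that by simp
qed

text \<open>Writing each \<open>zeros {i}\<close> entry as the total v minus the
  \<open>ones {i}\<close> entry leaves a claim about vertices, decided by |S|. For S empty it is an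
  equality: v minus the face is the mass of the vertices in T. For S = {j} the face either equals
  the vertex j or j lies in T. For two elements of S, the pair together costs only one v, which
  gives the missing -1.\<close>

lemma column_iv_sum:
  assumes b: "small_face k \<beta>" and a: "small_face k (ones S \<inter> zeros T)"
  shows "(\<Sum>i\<in>S. vmeasure x (ones {i} \<inter> \<beta>)) + (\<Sum>i\<in>T. vmeasure x (zeros {i} \<inter> \<beta>))
      - vmeasure x (ones S \<inter> zeros T \<inter> \<beta>)
    \<le> (real (card S) + real (card T) - 1) * vmeasure x \<beta>"
proof -
  let ?one = "\<lambda>i. vmeasure x (ones {i} \<inter> \<beta>)" and ?zero = "\<lambda>i. vmeasure x (zeros {i} \<inter> \<beta>)"
  let ?v = "vmeasure x \<beta>" and ?a = "vmeasure x (ones S \<inter> zeros T \<inter> \<beta>)"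
  have zero: "?zero i = ?v - ?one i" for i
    using vmeasure_ones_zeros[OF small_face_subset[OF b], of i] by simp
  then have sumT: "(\<Sum>i\<in>T. ?zero i) = real (card T) * ?v - (\<Sum>i\<in>T. ?one i)"
    by (simp add: sum_subtractf)
  have onesT: "0 \<le> (\<Sum>i\<in>T. ?one i)"
    by (intro sum_nonneg vmeasure_vertex_nonneg)
  have a0: "0 \<le> ?a"
    using vmeasure_small_faces[OF a b] .
  consider "S = {}" | j where "S = {j}" | i j where "i \<noteq> j" "{i, j} \<subseteq> S"
  proof -
    have "S = {} \<or> (\<exists>j. S = {j}) \<or> (\<exists>i j. i \<noteq> j \<and> {i, j} \<subseteq> S)"
      by blast
    then show ?thesis
      using that by blast
  qed
  then show ?thesis
  proof cases
    case 1
    have eq: "zeros T \<inter> \<beta> = ones S \<inter> zeros T \<inter> \<beta>"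
      using 1 zeros_subset[of T] by auto
    have "?v - ?a = vmeasure x (\<beta> - zeros T \<inter> \<beta>)"
      unfolding eq[symmetric] by (rule vmeasure_Diff[symmetric]) auto
    also have "\<dots> = (\<Sum>i | axis i 1 \<in> \<beta> - zeros T \<inter> \<beta>. x $ i)"
      by (rule vmeasure_without_0) simp
    also have "{i. axis i 1 \<in> \<beta> - zeros T \<inter> \<beta>} = {i \<in> T. axis i 1 \<in> \<beta>}"
      by auto
    also have "(\<Sum>i\<in>{i \<in> T. axis i 1 \<in> \<beta>}. x $ i) = (\<Sum>i\<in>T. ?one i)"
      by (simp add: vmeasure_vertex sum.inter_filter)
    finally show ?thesis
      using 1 by (simp add: sumT algebra_simps)
  next
    case 2
    have "?one j - ?a \<le> (\<Sum>i\<in>T. ?one i)"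
    proof (cases "j \<in> T")
      case True
      then have "?one j \<le> (\<Sum>i\<in>T. ?one i)"
        by (intro member_le_sum) (auto simp: vmeasure_vertex_nonneg)
      then show ?thesis
        using a0 by simp
    next
      case False
      then have "?a = ?one j"
        using 2 by (simp add: vmeasure_vertex Int_assoc)
      then show ?thesis
        using onesT by simp
    qed
    then show ?thesis
      using 2 by (simp add: sumT algebra_simps)
  next
    case 3
    have "(\<Sum>i\<in>S. ?one i) = (\<Sum>l\<in>{i, j}. ?one l) + (\<Sum>l\<in>S - {i, j}. ?one l)"
      using 3 by (subst add.commute, intro sum.subset_diff) auto
    also have "\<dots> \<le> ?v + (\<Sum>l\<in>S - {i, j}. ?v)"
      using 3 vmeasure_vertices[OF b, of "{i, j}"] vmeasure_vertices[OF b, of "{_}"]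
      by (intro add_mono sum_mono) auto
    also have "\<dots> = (real (card S) - 1) * ?v"
    proof -
      have "card {i, j} \<le> card S"
        using 3 by (intro card_mono) auto
      then have "real (card S) = real (card (S - {i, j})) + 2"
        using 3 by (simp add: card_Diff_subset)
      then show ?thesis
        by (simp only:) (simp add: algebra_simps)
    qed
    finally show ?thesis
      using a0 onesT by (simp add: sumT algebra_simps)
  qed
qed

text \<open>After the face is enlarged to the total v, the left side is |Z| v - v for any Z of size
  |U| - r + 2, and v dominates the vertex masses over Z. Such a Z fits into U because r is at least
  2, and has at most k + 2 elements by \<open>small_face_below_bound\<close>. If r exceeds |U|, the
  coefficient is not positive.\<close>

lemma column_v_sum_disjoint:
  assumes b: "small_face k \<beta>" and a: "small_face k (zeros T \<inter> below U r)"
    and "U \<inter> T = {}" and "2 \<le> r"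
  shows "(real (card U) - (real r - 1)) * vmeasure x (zeros T \<inter> below U r \<inter> \<beta>)
    \<le> (\<Sum>i\<in>U. vmeasure x (zeros {i} \<inter> \<beta>))"
proof (cases "r \<le> card U")
  case False
  then have "(real (card U) - (real r - 1)) * vmeasure x (zeros T \<inter> below U r \<inter> \<beta>) \<le> 0"
    using vmeasure_small_faces[OF a b] by (intro mult_nonpos_nonneg) auto
  also have "0 \<le> (\<Sum>i\<in>U. vmeasure x (zeros {i} \<inter> \<beta>))"
    using vmeasure_zeros_bounds(1)[OF b] by (intro sum_nonneg)
  finally show ?thesis .
next
  case True
  let ?v = "vmeasure x \<beta>"
  have bound: "card U \<le> k + r"
    using small_face_below_bound[OF a assms(3,4) True] .
  have "card U - r + 2 \<le> card U"
    using True assms(4) by simp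
  then obtain Z where Z: "Z \<subseteq> U" "card Z = card U - r + 2"
    by (meson obtain_subset_with_card_n)
  have "(real (card U) - (real r - 1)) * vmeasure x (zeros T \<inter> below U r \<inter> \<beta>)
      \<le> (real (card U) - (real r - 1)) * ?v"
    using True vmeasure_le_whole[OF b thin_small_face[OF a]] by (intro mult_left_mono) auto
  also have "\<dots> = real (card Z) * ?v - ?v"
    using Z(2) True by (simp add: of_nat_diff algebra_simps)
  also have "\<dots> \<le> real (card Z) * ?v - (\<Sum>i\<in>Z. vmeasure x (ones {i} \<inter> \<beta>))"
    using vmeasure_vertices[OF b, of Z] Z(2) bound by simp
  also have "\<dots> = (\<Sum>i\<in>Z. ?v - vmeasure x (ones {i} \<inter> \<beta>))"
    by (simp add: sum_subtractf)
  also have "\<dots> = (\<Sum>i\<in>Z. vmeasure x (zeros {i} \<inter> \<beta>))"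
    using vmeasure_ones_zeros[OF small_face_subset[OF b]] by (intro sum.cong) (auto simp: algebra_simps)
  also have "\<dots> \<le> (\<Sum>i\<in>U. vmeasure x (zeros {i} \<inter> \<beta>))"
    using Z(1) vmeasure_zeros_bounds(1)[OF b] by (intro sum_mono2) auto
  finally show ?thesis .
qed

text \<open>A nonempty S leaves at most one vertex e_j in the face, and for i other than j the
  \<open>zeros {i}\<close> entry dominates that of vertex j. With S empty, r = 0 gives the empty
  set, r = 1 puts the face inside every \<open>zeros {i}\<close>, and larger r reduces to the
  disjoint case.\<close>

lemma column_v_sum:
  assumes b: "small_face k \<beta>" and a: "small_face k (ones S \<inter> zeros T \<inter> below U r)"
  shows "(real (card U) - (real r - 1)) * vmeasure x (ones S \<inter> zeros T \<inter> below U r \<inter> \<beta>)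
    \<le> (\<Sum>i\<in>U. vmeasure x (zeros {i} \<inter> \<beta>))"
proof -
  define \<alpha> where "\<alpha> = ones S \<inter> zeros T \<inter> below U r"
  let ?a = "vmeasure x (\<alpha> \<inter> \<beta>)" and ?zero = "\<lambda>i. vmeasure x (zeros {i} \<inter> \<beta>)"
  have a': "small_face k \<alpha>"
    using a by (simp add: \<alpha>_def)
  have a0: "0 \<le> ?a"
    using vmeasure_small_faces[OF a' b] .
  have zero0: "0 \<le> ?zero i" for i
    using vmeasure_zeros_bounds(1)[OF b] .
  have le: "?a \<le> ?zero i" if "\<alpha> \<subseteq> zeros {i}" for i
    using vmeasure_le_zeros[OF b thin_small_face[OF a'] that] .
  have "(real (card U) - (real r - 1)) * ?a \<le> (\<Sum>i\<in>U. ?zero i)"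
  proof (cases "S = {}")
    case False
    then have n0: "0 \<notin> \<alpha> \<inter> \<beta>"
      by (simp add: \<alpha>_def)
    show ?thesis
    proof (cases "\<exists>j. axis j 1 \<in> \<alpha> \<inter> \<beta>")
      case False
      then have "?a = 0"
        using n0 by (intro vmeasure_eq_0) auto
      then show ?thesis
        using zero0 by (simp add: sum_nonneg)
    next
      case True
      then obtain j where j: "axis j 1 \<in> \<alpha> \<inter> \<beta>" by blast
      then have S: "S = {j}" and r: "(if j \<in> U then 1 else 0) < r"
        using \<open>S \<noteq> {}\<close> by (auto simp: \<alpha>_def)
      then have a_le: "?a \<le> vmeasure x (ones {j} \<inter> \<beta>)"
        by (intro vmeasure_le_ones[OF b thin_small_face[OF a']]) (auto simp: \<alpha>_def)
      \<comment> \<open>If j is in U, membership of e_j needs r at least 2; otherwise r at least 1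
        suffices. Either way the coefficient loses as much as U - {j} does.\<close>
      have "real (card U) - (real r - 1) \<le> real (card (U - {j}))"
        using r by (auto simp: card_Diff_singleton_if of_nat_diff split: if_splits)
      then have "(real (card U) - (real r - 1)) * ?a \<le> real (card (U - {j})) * ?a"
        using a0 by (intro mult_right_mono)
      also have "\<dots> = (\<Sum>i\<in>U - {j}. ?a)"
        by simp
      also have "\<dots> \<le> (\<Sum>i\<in>U - {j}. ?zero i)"
      proof (rule sum_mono)
        fix i assume "i \<in> U - {j}"
        then show "?a \<le> ?zero i"
          using a_le vmeasure_zeros_bounds(3)[OF b, of j i] by (cases "j = i") auto
      qed
      also have "\<dots> \<le> (\<Sum>i\<in>U. ?zero i)"
        using zero0 by (intro sum_mono2) auto
      finally show ?thesis .
    qed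
  next
    case True
    then have \<alpha>: "\<alpha> = zeros T \<inter> below U r"
      using zeros_subset[of T] by (auto simp: \<alpha>_def)
    consider "r = 0" | "r = 1" | "2 \<le> r"
      by linarith
    then show ?thesis
    proof cases
      case 1
      then have "\<alpha> = {}"
        by (auto simp: \<alpha> below_iff)
      then show ?thesis
        using zero0 by (simp add: sum_nonneg)
    next
      case 2
      have "(\<Sum>i\<in>U. ?a) \<le> (\<Sum>i\<in>U. ?zero i)"
      proof (rule sum_mono, rule le)
        fix i assume "i \<in> U"
        then show "\<alpha> \<subseteq> zeros {i}"
          using 2 by (auto simp: \<alpha> below_iff zeros_def cube01_def)
      qed
      then show ?thesis
        using 2 by simp
    next
      case 3
      \<comment> \<open>On the face the coordinates in T are 0, so U - T obeys the same bound r, and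
        each element of U \<inter> T pays with its own term.\<close>
      let ?U = "U - T"
      have eq: "\<alpha> = zeros T \<inter> below ?U r"
      proof -
        have "{i \<in> U. p $ i = 1} = {i \<in> ?U. p $ i = 1}" if "p \<in> zeros T" for p
          using that by (auto simp: zeros_def)
        then show ?thesis
          by (auto simp: \<alpha> below_iff)
      qed
      have "(real (card ?U) - (real r - 1)) * ?a \<le> (\<Sum>i\<in>?U. ?zero i)"
        unfolding eq by (rule column_v_sum_disjoint[OF b]) (use a' 3 in \<open>auto simp flip: eq\<close>)
      moreover have "(\<Sum>i\<in>U \<inter> T. ?a) \<le> (\<Sum>i\<in>U \<inter> T. ?zero i)"
        by (intro sum_mono le) (auto simp: \<alpha> zeros_def)
      moreover have "(\<Sum>i\<in>U. ?zero i) = (\<Sum>i\<in>?U. ?zero i) + (\<Sum>i\<in>U \<inter> T. ?zero i)"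
        using sum.Int_Diff[of U ?zero T] by simp
      moreover have "card U = card ?U + card (U \<inter> T)"
        using card_Un_disjoint[of "U - T" "U \<inter> T"] by (auto simp: Un_Diff_Int)
      ultimately show ?thesis
        by (simp add: algebra_simps)
    qed
  qed
  then show ?thesis
    by (simp add: \<alpha>_def)
qed

section \<open>Light weights belong to both relaxations\<close>

lemma xhat_in_cone:
  assumes "small_face k \<beta>"
  shows "xhat (column (\<lambda>\<alpha> \<beta>. vmeasure x (\<alpha> \<inter> \<beta>)) \<beta>)
    \<in> homog_cone (obstruction_relaxation (FRAC_system complete_edges) k)"
proof -
  have "vmeasure x (ones {i} \<inter> \<beta>) + vmeasure x (ones {j} \<inter> \<beta>) \<le> vmeasure x \<beta>"
    if "i \<noteq> j" for i j
    using that vmeasure_vertices[OF assms, of "{i, j}"] by simp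
  moreover have "vmeasure x (ones {i} \<inter> \<beta>) \<le> vmeasure x \<beta>" for i
    using vmeasure_vertices[OF assms, of "{i}"] by simp
  ultimately show ?thesis
    unfolding obstruction_relaxation_complete xhat_def column_def
      Int_absorb1[OF small_face_subset[OF assms]]
    by (intro homog_cone_complete) (auto simp: vmeasure_vertex_nonneg)
qed

lemma mem_BZ':
  assumes "1 \<le> k"
  shows "x \<in> BZ' (FRAC_system complete_edges) k"
proof -
  let ?C = "FRAC_system (complete_edges :: 'n set set)"
  let ?I = "indices' ?C k"
  define Y where "Y = (\<lambda>\<alpha> \<beta>. vmeasure x (\<alpha> \<inter> \<beta>))"
  note small = indices'_small_face[of _ ?C k]
  have valid: "valid_column' ?C k (column Y \<beta>)" if "\<beta> \<in> ?I" for \<beta>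
  proof -
    have b: "small_face k \<beta>"
      using small that .
    note b1 = small_face_subset[OF b]
    have y: "column Y \<beta> \<alpha> = vmeasure x (\<alpha> \<inter> \<beta>)" for \<alpha>
      by (simp add: column_def Y_def)
    have iv: "column_iv' ?C k (column Y \<beta>)"
      unfolding column_iv'_def Let_def y Int_absorb1[OF b1]
    proof (intro allI impI conjI ballI)
      fix S T :: "'n set"
      assume a: "ones S \<inter> zeros T \<in> ?I"
      note thin = thin_small_face[OF small[OF a]]
      show "vmeasure x (ones S \<inter> zeros T \<inter> \<beta>) \<le> vmeasure x (ones {i} \<inter> \<beta>)" if "i \<in> S" for i
        using that by (intro vmeasure_le_ones[OF b thin]) (auto simp: ones_def)
      show "vmeasure x (ones S \<inter> zeros T \<inter> \<beta>) \<le> vmeasure x (zeros {i} \<inter> \<beta>)" if "i \<in> T" for i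
        using that by (intro vmeasure_le_zeros[OF b thin]) (auto simp: zeros_def)
      show "vmeasure x (ones S \<inter> zeros T \<inter> \<beta>)
          + vmeasure x (ones (S \<union> {i}) \<inter> zeros (T - {i}) \<inter> \<beta>)
        = vmeasure x (ones S \<inter> zeros (T - {i}) \<inter> \<beta>)" if "i \<in> T" for i
      proof -
        have "ones S \<inter> zeros (T - {i}) \<inter> \<beta> =
            (ones S \<inter> zeros T \<inter> \<beta>) \<union> (ones (S \<union> {i}) \<inter> zeros (T - {i}) \<inter> \<beta>)"
          using that by (auto simp: ones_def zeros_def cube01_def)
        moreover have "(ones S \<inter> zeros T \<inter> \<beta>) \<inter> (ones (S \<union> {i}) \<inter> zeros (T - {i}) \<inter> \<beta>) = {}"
          using that by (auto simp: ones_def zeros_def)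
        ultimately show ?thesis
          by (simp add: vmeasure_Un)
      qed
      show "(\<Sum>i\<in>S. vmeasure x (ones {i} \<inter> \<beta>)) + (\<Sum>i\<in>T. vmeasure x (zeros {i} \<inter> \<beta>))
          - vmeasure x (ones S \<inter> zeros T \<inter> \<beta>)
        \<le> (real (card S) + real (card T) - 1) * vmeasure x \<beta>"
        by (rule column_iv_sum[OF b small[OF a]])
    qed
    have v: "column_v' ?C k (column Y \<beta>)"
      unfolding column_v'_def Let_def y Int_absorb1[OF b1]
    proof (intro allI impI conjI ballI; elim conjE)
      fix S T U :: "'n set" and r
      assume a: "ones S \<inter> zeros T \<inter> below U r \<in> ?I"
      note thin = thin_small_face[OF small[OF a]]
      show "vmeasure x (ones S \<inter> zeros T \<inter> below U r \<inter> \<beta>) \<le> vmeasure x (ones {i} \<inter> \<beta>)"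
        if "i \<in> S" for i
        using that by (intro vmeasure_le_ones[OF b thin]) (auto simp: ones_def)
      show "vmeasure x (ones S \<inter> zeros T \<inter> below U r \<inter> \<beta>) \<le> vmeasure x (zeros {i} \<inter> \<beta>)"
        if "i \<in> T" for i
        using that by (intro vmeasure_le_zeros[OF b thin]) (auto simp: zeros_def)
      show "(real (card U) - (real r - 1)) * vmeasure x (ones S \<inter> zeros T \<inter> below U r \<inter> \<beta>)
          \<le> (\<Sum>i\<in>U. vmeasure x (zeros {i} \<inter> \<beta>))"
        by (rule column_v_sum[OF b small[OF a]])
      let ?A = "ones S \<inter> zeros T"
      \<comment> \<open>\<open>vmeasure_partition\<close> indexes faces by their zero coordinates,
        so U' is exchanged for its complement in U.\<close>
      have "(\<Sum>U' | U' \<subseteq> U \<and> r \<le> card U'. vmeasure x (ones (S \<union> U') \<inter> zeros (T \<union> (U - U')) \<inter> \<beta>))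
        = (\<Sum>V | V \<subseteq> U \<and> r \<le> card (U - V). vmeasure x (?A \<inter> ones (U - V) \<inter> zeros V \<inter> \<beta>))"
        by (rule sum.reindex_bij_witness[of _ "\<lambda>V. U - V" "\<lambda>V. U - V"])
          (auto simp: double_diff Diff_Diff_Int Int_absorb1 ones_def zeros_def intro!: arg_cong[of _ _ "vmeasure x"])
      also have "\<dots> = vmeasure x {p \<in> ?A \<inter> \<beta>. r \<le> card (U - {i \<in> U. p $ i = 0})}"
        by (rule vmeasure_partition) (use ones_subset in auto)
      also have "{p \<in> ?A \<inter> \<beta>. r \<le> card (U - {i \<in> U. p $ i = 0})} =
          ?A \<inter> \<beta> - ?A \<inter> below U r \<inter> \<beta>"
      proof -
        have "U - {i \<in> U. p $ i = 0} = {i \<in> U. p $ i = 1}" if "p \<in> cube01" for p :: "real ^ 'n"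
          using that by (auto simp: cube01_def)
        then show ?thesis
          using b1 by (auto simp: below_iff subset_iff)
      qed
      also have "vmeasure x \<dots> = vmeasure x (?A \<inter> \<beta>) - vmeasure x (?A \<inter> below U r \<inter> \<beta>)"
        by (rule vmeasure_Diff) auto
      finally show "vmeasure x (?A \<inter> below U r \<inter> \<beta>) = vmeasure x (?A \<inter> \<beta>)
        - (\<Sum>U' | U' \<subseteq> U \<and> r \<le> card U'. vmeasure x (ones (S \<union> U') \<inter> zeros (T \<union> (U - U')) \<inter> \<beta>))"
        by simp
    qed
    show ?thesis
      unfolding valid_column'_def y Int_absorb1[OF b1]
      using iv[unfolded y] v[unfolded y] xhat_in_cone[OF b, unfolded column_def] vmeasure_small_faces[OF small b]
        vmeasure_le_whole[OF b thin_small_face[OF small]] vmeasure_ones_zeros[OF b1]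
      by blast
  qed
  \<comment> \<open>The support of the measure lies in P, so hulls with no common point in P leave
    \<alpha> \<inter> \<beta> without any point of the support.\<close>
  have "Y \<alpha> \<beta> = 0" if "(convex hull \<alpha>) \<inter> (convex hull \<beta>) \<inter> polytope_of ?C = {}" for \<alpha> \<beta>
  proof -
    have "p \<notin> \<alpha> \<inter> \<beta>" if "p \<in> FRAC complete_edges" for p
      using that \<open>_ = {}\<close> hull_inc[of p] by (auto simp: polytope_complete)
    then show ?thesis
      unfolding Y_def using cube_in_FRAC_complete by (intro vmeasure_eq_0) blast+
  qed
  moreover have "Y cube01 cube01 = 1"
    by (simp add: Y_def vmeasure_with_0)
  moreover have "symmetric_on ?I Y"
    by (simp add: symmetric_on_def Y_def Int_commute)
  moreover have "intersection_consistent ?I Y"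
    by (simp add: intersection_consistent_def Y_def)
  ultimately have "Y \<in> BZ'_lift ?C k"
    using valid by (auto simp: BZ'_lift_def)
  moreover have "xhat (column Y cube01) = (1, x)"
    by (simp add: xhat_def column_def Y_def vmeasure_with_0 vmeasure_vertex vec_eq_iff)
  ultimately show ?thesis
    unfolding BZ'_def by blast
qed

lemma mem_BZ:
  assumes "1 \<le> k"
  shows "x \<in> BZ (FRAC_system complete_edges) k"
proof -
  let ?C = "FRAC_system (complete_edges :: 'n set set)"
  let ?I = "indices ?C k"
  define Y where "Y = (\<lambda>\<alpha> \<beta>. vmeasure x (\<alpha> \<inter> \<beta>))"
  note small = indices_small_face[OF assms, of _ ?C]
  have valid: "valid_column ?C k (column Y \<beta>)" if "\<beta> \<in> ?I" for \<beta>
  proof -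
    have b: "small_face k \<beta>"
      using small that .
    note b1 = small_face_subset[OF b]
    have y: "column Y \<beta> \<alpha> = vmeasure x (\<alpha> \<inter> \<beta>)" for \<alpha>
      by (simp add: column_def Y_def)
    have iv: "column_iv ?C k (column Y \<beta>)"
      unfolding column_iv_def Let_def y Int_absorb1[OF b1]
    proof (intro allI impI conjI ballI)
      fix S T :: "'n set"
      assume a: "ones S \<inter> zeros T \<in> ?I"
      note thin = thin_small_face[OF small[OF a]]
      show "vmeasure x (ones S \<inter> zeros T \<inter> \<beta>) \<le> vmeasure x (ones {i} \<inter> \<beta>)" if "i \<in> S" for i
        using that by (intro vmeasure_le_ones[OF b thin]) (auto simp: ones_def)
      show "vmeasure x (ones S \<inter> zeros T \<inter> \<beta>) \<le> vmeasure x (zeros {i} \<inter> \<beta>)" if "i \<in> T" for i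
        using that by (intro vmeasure_le_zeros[OF b thin]) (auto simp: zeros_def)
      show "(\<Sum>i\<in>S. vmeasure x (ones {i} \<inter> \<beta>)) + (\<Sum>i\<in>T. vmeasure x (zeros {i} \<inter> \<beta>))
          - vmeasure x (ones S \<inter> zeros T \<inter> \<beta>)
        \<le> (real (card S) + real (card T) - 1) * vmeasure x \<beta>"
        by (rule column_iv_sum[OF b small[OF a]])
    qed
    have v: "column_v ?C k (column Y \<beta>)"
      unfolding column_v_def Let_def y Int_absorb1[OF b1]
    proof (intro allI impI conjI ballI)
      fix S T U :: "'n set" and r
      assume a: "ones S \<inter> zeros T \<inter> below U r \<in> ?I"
      note thin = thin_small_face[OF small[OF a]]
      show "vmeasure x (ones S \<inter> zeros T \<inter> below U r \<inter> \<beta>) \<le> vmeasure x (ones {i} \<inter> \<beta>)"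
        if "i \<in> S" for i
        using that by (intro vmeasure_le_ones[OF b thin]) (auto simp: ones_def)
      show "vmeasure x (ones S \<inter> zeros T \<inter> below U r \<inter> \<beta>) \<le> vmeasure x (zeros {i} \<inter> \<beta>)"
        if "i \<in> T" for i
        using that by (intro vmeasure_le_zeros[OF b thin]) (auto simp: zeros_def)
      show "(real (card U) - (real r - 1)) * vmeasure x (ones S \<inter> zeros T \<inter> below U r \<inter> \<beta>)
          \<le> (\<Sum>i\<in>U. vmeasure x (zeros {i} \<inter> \<beta>))"
        by (rule column_v_sum[OF b small[OF a]])
    qed
    have vi: "column_vi ?C k (column Y \<beta>)"
      unfolding column_vi_def Let_def y Int_absorb1[OF b1]
    proof (intro allI impI)
      fix Ws Ts :: "'n set list" and W T :: "'n set"
      let ?A = "tuple_face Ws Ts" and ?m = "k - sum_list (map card Ts)"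
      assume tier: "length Ts = length Ws \<and> tier_tuple ?C k (Ws @ [W]) (Ts @ [T])"
      have A: "?A \<subseteq> cube01"
        using ones_subset by (auto simp: tuple_face_def)
      show "if card W + sum_list (map card Ts) \<le> k
        then (\<Sum>U | U \<subseteq> W. vmeasure x (?A \<inter> ones (W - U) \<inter> zeros U \<inter> \<beta>)) = vmeasure x (?A \<inter> \<beta>)
        else (\<Sum>U | U \<subseteq> W \<and> card U \<le> ?m. vmeasure x (?A \<inter> ones (W - U) \<inter> zeros U \<inter> \<beta>))
             + vmeasure x (?A \<inter> below W (card W - ?m) \<inter> \<beta>) = vmeasure x (?A \<inter> \<beta>)"
      proof (cases "card W + sum_list (map card Ts) \<le> k")
        case True
        then show ?thesis
          using vmeasure_partition[OF A, where W = W and Q = "\<lambda>_. True" and B = \<beta>]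
          by (simp add: Collect_conj_eq)
      next
        case False
        \<comment> \<open>The tier condition bounds the sizes in Ts by k, so neither
          \<open>?m\<close> nor \<open>card W - ?m\<close> is a truncated difference.\<close>
        then have m: "?m < card W"
          using tier by (auto simp: tier_tuple_def)
        have split: "card {i \<in> W. p $ i = 1} = card W - card {i \<in> W. p $ i = 0}"
          if "p \<in> cube01" for p :: "real ^ 'n"
        proof -
          have "{i \<in> W. p $ i = 1} = W - {i \<in> W. p $ i = 0}"
            using that by (auto simp: cube01_def)
          then show ?thesis
            by (simp add: card_Diff_subset)
        qed
        have "p \<in> below W (card W - ?m) \<longleftrightarrow> \<not> card {i \<in> W. p $ i = 0} \<le> ?m"
          if "p \<in> cube01" for p :: "real ^ 'n"
        proof -
          have "card {i \<in> W. p $ i = 0} \<le> card W"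
            by (intro card_mono) auto
          then show ?thesis
            using that split[OF that] m by (auto simp: below_iff)
        qed
        then have "{p \<in> ?A \<inter> \<beta>. card {i \<in> W. p $ i = 0} \<le> ?m} =
            ?A \<inter> \<beta> - ?A \<inter> below W (card W - ?m) \<inter> \<beta>"
          using A by blast
        then have "(\<Sum>U | U \<subseteq> W \<and> card U \<le> ?m. vmeasure x (?A \<inter> ones (W - U) \<inter> zeros U \<inter> \<beta>)) =
            vmeasure x (?A \<inter> \<beta> - ?A \<inter> below W (card W - ?m) \<inter> \<beta>)"
          using vmeasure_partition[OF A, where W = W and Q = "\<lambda>U. card U \<le> ?m" and B = \<beta>] by simp
        also have "\<dots> = vmeasure x (?A \<inter> \<beta>) - vmeasure x (?A \<inter> below W (card W - ?m) \<inter> \<beta>)"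
          by (rule vmeasure_Diff) auto
        finally show ?thesis
          using False by simp
      qed
    qed
    show ?thesis
      unfolding valid_column_def y Int_absorb1[OF b1]
      using iv[unfolded y] v[unfolded y] vi[unfolded y] xhat_in_cone[OF b, unfolded column_def] vmeasure_small_faces[OF small b]
        vmeasure_le_whole[OF b thin_small_face[OF small]] vmeasure_ones_zeros[OF b1]
      by blast
  qed
  have "Y \<alpha> \<beta> = 0" if null: "\<alpha> \<inter> \<beta> = {} \<or> (\<exists>Ob\<in>small_obstructions ?C k. \<alpha> \<inter> \<beta> \<subseteq> ones Ob)" for \<alpha> \<beta>
  proof (cases "\<alpha> \<inter> \<beta> = {}")
    case False
    then obtain Ob where "Ob \<in> small_obstructions ?C k" and sub: "\<alpha> \<inter> \<beta> \<subseteq> ones Ob"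
      using null by blast
    then obtain i j where "i \<noteq> j" and Ob: "Ob = {i, j}"
      unfolding small_obstructions_complete by (auto simp: complete_edges_def)
    then have "0 \<notin> ones {i, j}" "axis l 1 \<notin> ones {i, j}" for l
      by auto
    then show ?thesis
      unfolding Y_def using sub[unfolded Ob] by (intro vmeasure_eq_0) blast+
  qed (simp add: Y_def)
  moreover have "Y cube01 cube01 = 1"
    by (simp add: Y_def vmeasure_with_0)
  moreover have "symmetric_on ?I Y"
    by (simp add: symmetric_on_def Y_def Int_commute)
  moreover have "intersection_consistent ?I Y"
    by (simp add: intersection_consistent_def Y_def)
  ultimately have "Y \<in> BZ_lift ?C k"
    using valid by (auto simp: BZ_lift_def)
  moreover have "xhat (column Y cube01) = (1, x)"
    by (simp add: xhat_def column_def Y_def vmeasure_with_0 vmeasure_vertex vec_eq_iff)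
  ultimately show ?thesis
    unfolding BZ_def by blast
qed

end

section \<open>The upper bound\<close>

text \<open>An abstract index family serves both operators. In the column of \<open>zeros T1\<close>
  a vertex i of T2 keeps its full weight: consistency moves the entry to the face
  \<open>ones {i} \<inter> zeros T1\<close> in the column of \<open>cube01\<close>, where
  \<open>drop\<close> removes T1. Disjointness provides the side condition that i is not in
  T1.\<close>

lemma sum_over_disjoint_le_1:
  assumes sym: "symmetric_on I Y" and cons: "intersection_consistent I Y" and one: "Y cube01 cube01 = 1"
    and cube: "cube01 \<in> I" and vertex: "\<And>i. ones {i} \<in> I"
    and zeros: "\<And>T. card T \<le> k \<Longrightarrow> zeros T \<in> I"
    and mixed: "\<And>i T. card T \<le> k \<Longrightarrow> i \<notin> T \<Longrightarrow> ones {i} \<inter> zeros T \<in> I"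
    and nonneg: "\<And>\<alpha> \<beta>. \<alpha> \<in> I \<Longrightarrow> \<beta> \<in> I \<Longrightarrow> 0 \<le> Y \<alpha> \<beta>"
    and split: "\<And>\<beta> T. \<beta> \<in> I \<Longrightarrow> card T \<le> k \<Longrightarrow>
      Y (zeros T) \<beta> + (\<Sum>i\<in>T. Y (ones {i}) \<beta>) = Y cube01 \<beta>"
    and drop: "\<And>i T. card T \<le> k \<Longrightarrow> i \<notin> T \<Longrightarrow>
      Y (ones {i} \<inter> zeros T) cube01 = Y (ones {i}) cube01"
    and T: "card T1 \<le> k" "card T2 \<le> k" "T1 \<inter> T2 = {}"
  shows "(\<Sum>i\<in>T1 \<union> T2. Y (ones {i}) cube01) \<le> 1"
proof -
  have vert: "Y (ones {i}) (zeros T1) = Y (ones {i}) cube01" if "i \<in> T2" for i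
  proof -
    have i: "i \<notin> T1"
      using that T(3) by auto
    have "ones {i} \<inter> zeros T1 = (ones {i} \<inter> zeros T1) \<inter> cube01"
      using ones_subset by auto
    then have "Y (ones {i}) (zeros T1) = Y (ones {i} \<inter> zeros T1) cube01"
      using cons vertex zeros[OF T(1)] mixed[OF T(1) i] cube
      unfolding intersection_consistent_def by blast
    then show ?thesis
      using drop[OF T(1) i] by simp
  qed
  have "(\<Sum>i\<in>T2. Y (ones {i}) cube01) = (\<Sum>i\<in>T2. Y (ones {i}) (zeros T1))"
    using vert by (intro sum.cong) auto
  also have "\<dots> \<le> Y cube01 (zeros T1)"
    using split[OF zeros[OF T(1)] T(2)] nonneg[OF zeros[OF T(2)] zeros[OF T(1)]] by linarith
  also have "\<dots> = Y (zeros T1) cube01"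
    using sym cube zeros[OF T(1)] by (simp add: symmetric_on_def)
  also have "\<dots> = 1 - (\<Sum>i\<in>T1. Y (ones {i}) cube01)"
    using split[OF cube T(1)] one by linarith
  finally show ?thesis
    using T(3) by (simp add: sum.union_disjoint)
qed

section \<open>Upper bound for BZ'\<close>

lemma convex_hull_edge_disjoint:
  fixes \<alpha> :: "(real ^ 'n::finite) set"
  assumes "i \<noteq> j" and "\<alpha> \<subseteq> ones {i, j}"
  shows "(convex hull \<alpha>) \<inter> A \<inter> FRAC complete_edges = {}"
proof -
  have "convex {p :: real ^ 'n. p $ i = 1 \<and> p $ j = 1}"
    by (auto simp: convex_def)
  then have "convex hull \<alpha> \<subseteq> {p. p $ i = 1 \<and> p $ j = 1}"
    using assms(2) by (intro hull_minimal) (auto simp: ones_def)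
  moreover have "p \<notin> FRAC complete_edges" if "p $ i = 1 \<and> p $ j = 1" for p :: "real ^ 'n"
  proof
    assume "p \<in> FRAC complete_edges"
    then have "p $ i + p $ j \<le> 1"
      using assms(1) by (simp add: FRAC_complete)
    then show False
      using that by simp
  qed
  ultimately show ?thesis
    by blast
qed

lemma wall_of_edge:
  assumes "a \<noteq> b"
  shows "wall_of [{a, b}, {a, b}] = {a, b}"
proof (rule set_eqI)
  fix x
  show "x \<in> wall_of [{a, b}, {a, b}] \<longleftrightarrow> x \<in> {a, b}"
    unfolding wall_of_iff by auto
qed

text \<open>An edge listed twice is a wall with two elements, so one such wall and k - 1 singletons
  cover k + 1 elements. The extra element is essential for \<open>ones {i} \<inter> zeros T\<close>
  with |T| = k.\<close>

lemma small_set_in_tiers':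
  fixes S :: "'n::finite set"
  assumes "card S \<le> k + 1" and "2 \<le> k" and "2 \<le> CARD('n)"
  shows "S \<in> tiers' (FRAC_system complete_edges) k"
proof -
  obtain a b where ab: "a \<noteq> b" and c: "card (S - {a, b}) \<le> k - 1"
  proof (cases "card S \<le> 1")
    case True
    obtain a b :: 'n where "a \<noteq> b"
      using assms(3) card_le_Suc0_iff_eq[of "UNIV :: 'n set"] by auto
    moreover have "card (S - {a, b}) \<le> card S"
      by (intro card_mono) auto
    ultimately show ?thesis
      using that[of a b] True assms(2) by simp
  next
    case False
    then obtain a b where "a \<in> S" "b \<in> S" "a \<noteq> b"
      using card_le_Suc0_iff_eq[of S] by auto
    then show ?thesis
      using that[of a b] assms(1) by (simp add: card_Diff_subset)
  qed
  obtain xs where xs: "set xs = S - {a, b}" "distinct xs"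
    using finite_distinct_list[of "S - {a, b}"] by auto
  then have len: "length xs \<le> k - 1"
    using c distinct_card[of xs] by simp
  \<comment> \<open>A tier takes exactly k walls; copies of \<open>{a}\<close> pad the list.\<close>
  define Ws where "Ws = {a, b} # map (\<lambda>x. {x}) xs @ replicate (k - 1 - length xs) {a}"
  let ?W = "walls' (FRAC_system (complete_edges :: 'n set set)) k"
  have "{a, b} \<in> complete_edges"
    using ab by (auto simp: complete_edges_def)
  then have "{a, b} \<in> ?W"
    unfolding walls'_def small_obstructions_complete
    using wall_of_edge[OF ab] assms(2) by (intro UnI1) (force intro!: exI[of _ "[{a, b}, {a, b}]"])
  moreover have "{x} \<in> ?W" for x
    by (auto simp: walls'_def)
  ultimately have "set Ws \<subseteq> ?W"
    by (auto simp: Ws_def set_replicate_conv_if)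
  moreover have "length Ws = k"
    using len assms(2) by (simp add: Ws_def)
  moreover have "S \<subseteq> \<Union>(set Ws)"
    using xs(1) by (auto simp: Ws_def)
  ultimately show ?thesis
    unfolding tiers'_def by blast
qed

lemma sum_coordinates_BZ':
  fixes x :: "real ^ 'n::finite"
  assumes x: "x \<in> BZ' (FRAC_system complete_edges) k" and k: "2 \<le> k" "2 \<le> CARD('n)"
  shows "0 \<le> x $ i"
    and "card T1 \<le> k \<Longrightarrow> card T2 \<le> k \<Longrightarrow> T1 \<inter> T2 = {} \<Longrightarrow> (\<Sum>i\<in>T1 \<union> T2. x $ i) \<le> 1"
proof -
  let ?C = "FRAC_system (complete_edges :: 'n set set)"
  let ?I = "indices' ?C k"
  obtain Y where Y: "Y \<in> BZ'_lift ?C k" and xY: "xhat (column Y cube01) = (1, x)"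
    using x by (auto simp: BZ'_def)
  have x_eq: "x $ i = Y (ones {i}) cube01" for i
    using xY by (auto simp: xhat_def column_def)
  have sym: "symmetric_on ?I Y" and cons: "intersection_consistent ?I Y" and one: "Y cube01 cube01 = 1"
    and col: "\<And>\<beta>. \<beta> \<in> ?I \<Longrightarrow> valid_column' ?C k (column Y \<beta>)"
    and null: "\<And>\<alpha> \<beta>. \<alpha> \<in> ?I \<Longrightarrow> \<beta> \<in> ?I \<Longrightarrow>
      (convex hull \<alpha>) \<inter> (convex hull \<beta>) \<inter> polytope_of ?C = {} \<Longrightarrow> Y \<alpha> \<beta> = 0"
    using Y by (auto simp: BZ'_lift_def)
  have index: "ones S \<inter> zeros T \<in> ?I" if "card (S \<union> T) \<le> k + 1" "card T \<le> k" "S \<inter> T = {}" for S T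
  proof -
    have "ones S \<inter> zeros T = ones ((S \<union> T) - T) \<inter> zeros T"
      using that(3) by (simp add: Un_Diff Diff_triv)
    then show ?thesis
      using small_set_in_tiers'[OF that(1) k] that(2) unfolding indices'_def by blast
  qed
  have zeros: "zeros T \<in> ?I" if "card T \<le> k" for T
    using index[of "{}" T] that zeros_subset[of T] by (simp add: Int_absorb1)
  have cube: "cube01 \<in> ?I"
    using zeros[of "{}"] by simp
  have mixed: "ones {i} \<inter> zeros T \<in> ?I" if "card T \<le> k" "i \<notin> T" for i T
    using index[of "{i}" T] that by simp
  have vertex: "ones {i} \<in> ?I" for i
    using mixed[of "{}" i] ones_subset[of "{i}"] by (simp add: Int_absorb2)
  have nonneg: "0 \<le> Y \<alpha> \<beta>" if "\<alpha> \<in> ?I" "\<beta> \<in> ?I" for \<alpha> \<beta>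
    using col[OF that(2)] that(1) by (auto simp: valid_column'_def column_def)
  have step: "Y (ones S \<inter> zeros (insert i T)) \<beta> + Y (ones (insert i S) \<inter> zeros T) \<beta> = Y (ones S \<inter> zeros T) \<beta>"
    if "\<beta> \<in> ?I" "ones S \<inter> zeros (insert i T) \<in> ?I" "i \<notin> T" for S T i \<beta>
    using col[OF that(1)] that(2,3)
    unfolding valid_column'_def column_iv'_def Let_def column_def
    by (elim conjE allE[of _ S] allE[of _ "insert i T"]) (auto dest!: bspec[of _ _ i])
  \<comment> \<open>With |T| < k the set {i, j} \<union> T has at most k + 1 elements, so the face
    is an index.\<close>
  have null2: "Y (ones {i, j} \<inter> zeros T) \<beta> = 0"
    if "\<beta> \<in> ?I" "i \<noteq> j" "card T < k" "i \<notin> T" "j \<notin> T" for i j T \<beta>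
    using that index[of "{i, j}" T] unfolding polytope_complete
    by (intro null) (auto simp: polytope_complete convex_hull_edge_disjoint)
  \<comment> \<open>Each j moved to the zero side changes the entry by that of a face with both i
    and j at 1, which vanishes.\<close>
  have drop: "Y (ones {i} \<inter> zeros T) \<beta> = Y (ones {i}) \<beta>"
    if "\<beta> \<in> ?I" "card T \<le> k" "i \<notin> T" for i T \<beta>
    using finite[of T] that(2,3)
  proof (induction T rule: finite_induct)
    case empty
    then show ?case
      using ones_subset[of "{i}"] by (simp add: Int_absorb2)
  next
    case (insert j T)
    have "Y (ones {i} \<inter> zeros (insert j T)) \<beta> + Y (ones {j, i} \<inter> zeros T) \<beta> = Y (ones {i} \<inter> zeros T) \<beta>"
      using insert by (intro step[OF that(1) mixed]) auto
    moreover have "Y (ones {j, i} \<inter> zeros T) \<beta> = 0"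
      using insert by (intro null2[OF that(1)]) auto
    ultimately show ?case
      using insert by simp
  qed
  \<comment> \<open>Moving j to the zero side costs the entry of
    \<open>ones {j} \<inter> zeros T\<close>, which \<open>drop\<close> replaces by that of
    \<open>ones {j}\<close>.\<close>
  have split: "Y (zeros T) \<beta> + (\<Sum>i\<in>T. Y (ones {i}) \<beta>) = Y cube01 \<beta>"
    if "\<beta> \<in> ?I" "card T \<le> k" for T \<beta>
    using finite[of T] that(2)
  proof (induction T rule: finite_induct)
    case (insert j T)
    have "Y (ones {} \<inter> zeros (insert j T)) \<beta> + Y (ones {j} \<inter> zeros T) \<beta> = Y (ones {} \<inter> zeros T) \<beta>"
      using insert by (intro step[OF that(1) index]) auto
    moreover have "Y (ones {j} \<inter> zeros T) \<beta> = Y (ones {j}) \<beta>"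
      using insert by (intro drop[OF that(1)]) auto
    ultimately show ?case
      using insert by (simp add: zeros_subset Int_absorb1)
  qed simp
  show "0 \<le> x $ i"
    unfolding x_eq using nonneg[OF vertex cube] .
  show "(\<Sum>i\<in>T1 \<union> T2. x $ i) \<le> 1" if "card T1 \<le> k" "card T2 \<le> k" "T1 \<inter> T2 = {}"
    unfolding x_eq
    by (rule sum_over_disjoint_le_1[OF sym cons one cube vertex zeros mixed nonneg split drop[OF cube] that])
qed

section \<open>Upper bound for BZ\<close>

lemma wall_of_Cons_Cons: "wall_of (e # e # Os) = e \<union> wall_of Os"
proof (rule set_eqI)
  fix x
  show "x \<in> wall_of (e # e # Os) \<longleftrightarrow> x \<in> e \<union> wall_of Os"
    by (simp add: wall_of_iff)
qed

text \<open>Elements are consumed in pairs: an edge listed twice contributes both endpoints for two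
  entries. A last single a is the wall of two edges meeting in a, which takes three vertices, and a
  single edge has the empty wall; hence the +1.\<close>

lemma ex_wall_of_complete:
  fixes T :: "'n::finite set"
  assumes "3 \<le> CARD('n)"
  shows "\<exists>Os. set Os \<subseteq> complete_edges \<and> 1 \<le> length Os \<and> length Os \<le> card T + 1 \<and> wall_of Os = T"
proof (induction "card T" arbitrary: T rule: less_induct)
  case less
  have edge: "{a, b} \<in> complete_edges" if "a \<noteq> b" for a b :: 'n
    using that by (auto simp: complete_edges_def)
  have other: "\<exists>b. b \<notin> A" if "card A \<le> 2" for A :: "'n set"
  proof -
    have "A \<noteq> UNIV"
      using that assms by auto
    then show ?thesis by auto
  qed
  consider "T = {}" | a where "T = {a}" | a b where "a \<noteq> b" "a \<in> T" "b \<in> T"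
    by blast
  then show ?case
  proof cases
    case 1
    obtain a b :: 'n where "a \<noteq> b"
      using other[of "{undefined}"] by auto
    then show ?thesis
      using 1 edge by (intro exI[of _ "[{a, b}]"]) (auto simp: wall_of_iff split: if_splits)
  next
    case 2
    obtain b where b: "b \<noteq> a"
      using other[of "{a}"] by auto
    obtain c where c: "c \<noteq> a" "c \<noteq> b"
      using other[of "{a, b}"] b by auto
    have "wall_of [{a, b}, {a, c}] = T"
    proof (rule set_eqI)
      fix x
      show "x \<in> wall_of [{a, b}, {a, c}] \<longleftrightarrow> x \<in> T"
        using b c 2 by (auto simp: wall_of_iff)
    qed
    then show ?thesis
      using 2 edge b c by (intro exI[of _ "[{a, b}, {a, c}]"]) auto
  next
    case 3
    have "card {a, b} \<le> card T"
      using 3 by (intro card_mono) auto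
    then have card: "card (T - {a, b}) + 2 = card T"
      using 3 by (simp add: card_Diff_subset)
    then obtain Os where Os: "set Os \<subseteq> complete_edges" "length Os \<le> card (T - {a, b}) + 1"
        "wall_of Os = T - {a, b}"
      using less[of "T - {a, b}"] by auto
    have "wall_of ({a, b} # {a, b} # Os) = T"
      using 3 Os(3) by (auto simp: wall_of_Cons_Cons)
    then show ?thesis
      using 3 Os card edge by (intro exI[of _ "{a, b} # {a, b} # Os"]) auto
  qed
qed

lemma small_set_in_walls:
  fixes T :: "'n::finite set"
  assumes "3 \<le> CARD('n)" and "card T \<le> k"
  shows "T \<in> walls (FRAC_system complete_edges) k"
proof -
  obtain Os :: "'n set list" where "set Os \<subseteq> complete_edges" "1 \<le> length Os" "length Os \<le> card T + 1"
      "T = wall_of Os"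
    using ex_wall_of_complete[OF assms(1), of T] by blast
  then show ?thesis
    unfolding walls_def small_obstructions_complete using assms(2) by force
qed

lemma sum_coordinates_BZ:
  fixes x :: "real ^ 'n::finite"
  assumes x: "x \<in> BZ (FRAC_system complete_edges) k" and k: "2 \<le> k" "3 \<le> CARD('n)"
  shows "0 \<le> x $ i"
    and "card T1 \<le> k \<Longrightarrow> card T2 \<le> k \<Longrightarrow> T1 \<inter> T2 = {} \<Longrightarrow> (\<Sum>i\<in>T1 \<union> T2. x $ i) \<le> 1"
proof -
  let ?C = "FRAC_system (complete_edges :: 'n set set)"
  let ?I = "indices ?C k"
  obtain Y where Y: "Y \<in> BZ_lift ?C k" and xY: "xhat (column Y cube01) = (1, x)"
    using x by (auto simp: BZ_def)
  have x_eq: "x $ i = Y (ones {i}) cube01" for i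
    using xY by (auto simp: xhat_def column_def)
  have sym: "symmetric_on ?I Y" and cons: "intersection_consistent ?I Y" and one: "Y cube01 cube01 = 1"
    and col: "\<And>\<beta>. \<beta> \<in> ?I \<Longrightarrow> valid_column ?C k (column Y \<beta>)"
    and null: "\<And>\<alpha> \<beta>. \<alpha> \<in> ?I \<Longrightarrow> \<beta> \<in> ?I \<Longrightarrow>
      (\<exists>Ob\<in>small_obstructions ?C k. \<alpha> \<inter> \<beta> \<subseteq> ones Ob) \<Longrightarrow> Y \<alpha> \<beta> = 0"
    using Y unfolding BZ_lift_def by blast+
  have cube: "cube01 \<in> ?I" and vertex: "\<And>i. ones {i} \<in> ?I"
    by (auto simp: indices_def)
  have tuple: "tuple_face Ws Ts \<in> ?I" if "tier_tuple ?C k Ws Ts" for Ws Ts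
    using that unfolding indices_def by blast
  have tier1: "tier_tuple ?C k [T] [U]" if "card T \<le> k" "U \<subseteq> T" for T U
    using that k small_set_in_walls[OF k(2) that(1)] card_mono[OF finite that(2)]
    by (auto simp: tier_tuple_def)
  have face1: "tuple_face [T] [U] = ones (T - U) \<inter> zeros U" for T U :: "'n set"
    by (simp add: tuple_face_def lessThan_Suc)
  \<comment> \<open>The walls {i} and T are kept separate so that T may have all k elements; two
    walls are available since k is at least 2.\<close>
  have tier2: "tier_tuple ?C k [{i}, T] [{}, U]" if "card T \<le> k" "U \<subseteq> T" for i T U
    using that k small_set_in_walls[OF k(2), of "{i}" k] small_set_in_walls[OF k(2) that(1)]
      card_mono[OF finite that(2)]
    by (auto simp: tier_tuple_def less_Suc_eq numeral_2_eq_2)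
  have face2: "tuple_face [{i}, T] [{}, U] = ones {i} \<inter> ones (T - U) \<inter> zeros U" for i and T U :: "'n set"
    by (auto simp: tuple_face_def lessThan_Suc ones_def)
  have zeros: "zeros T \<in> ?I" if "card T \<le> k" for T
    using tuple[OF tier1[OF that subset_refl]] zeros_subset[of T] by (simp add: face1 Int_absorb1)
  have mixed: "ones {i} \<inter> zeros T \<in> ?I" if "card T \<le> k" for i T
    using tuple[OF tier2[OF that subset_refl, of i]] ones_subset[of "{i}"]
    by (simp add: face2 Int_absorb2)
  have nonneg: "0 \<le> Y \<alpha> \<beta>" if "\<alpha> \<in> ?I" "\<beta> \<in> ?I" for \<alpha> \<beta>
    using col[OF that(2)] that(1) by (auto simp: valid_column_def column_def)
  have vi: "column_vi ?C k (column Y \<beta>)" if "\<beta> \<in> ?I" for \<beta>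
    using col[OF that] by (simp add: valid_column_def)
  have null2: "Y \<alpha> \<beta> = 0" if "\<alpha> \<in> ?I" "\<beta> \<in> ?I" "i \<noteq> j" "\<alpha> \<subseteq> ones {i, j}" for \<alpha> \<beta> i j
  proof -
    have "{i, j} \<in> small_obstructions ?C k"
      using that(3) unfolding small_obstructions_complete by (auto simp: complete_edges_def)
    then show ?thesis
      using that by (intro null) auto
  qed
  \<comment> \<open>Here the exchange equation of BZ' is replaced by \<open>column_vi\<close> for
    the walls {i} and T. Every summand with some j in T - U has both i and j at 1 and vanishes,
    leaving U = T.\<close>
  have drop: "Y (ones {i} \<inter> zeros T) \<beta> = Y (ones {i}) \<beta>"
    if b: "\<beta> \<in> ?I" and T: "card T \<le> k" "i \<notin> T" for i T \<beta>
  proof -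
    have "(\<Sum>U | U \<subseteq> T. Y (ones {i} \<inter> ones (T - U) \<inter> zeros U) \<beta>) = Y (ones {i}) \<beta>"
    proof -
      have "tier_tuple ?C k ([{i}] @ [T]) ([{}] @ [{}])"
        using tier2[OF T(1), of "{}" i] by simp
      moreover have "tuple_face [{i}] [{}] = ones {i}"
        using face1[of "{i}" "{}"] ones_subset[of "{i}"] by (simp add: Int_absorb2)
      ultimately show ?thesis
        using vi[OF b, unfolded column_vi_def, rule_format,
            where Ws = "[{i}]" and W = T and Ts = "[{}]" and T = "{}"] T(1)
        by (simp add: column_def Let_def)
    qed
    moreover have "(\<Sum>U | U \<subseteq> T. Y (ones {i} \<inter> ones (T - U) \<inter> zeros U) \<beta>) =
        (\<Sum>U\<in>{T}. Y (ones {i} \<inter> ones (T - U) \<inter> zeros U) \<beta>)"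
    proof (rule sum.mono_neutral_right)
      show "\<forall>U\<in>{U. U \<subseteq> T} - {T}. Y (ones {i} \<inter> ones (T - U) \<inter> zeros U) \<beta> = 0"
      proof
        fix U assume U: "U \<in> {U. U \<subseteq> T} - {T}"
        then obtain j where j: "j \<in> T - U" by auto
        then show "Y (ones {i} \<inter> ones (T - U) \<inter> zeros U) \<beta> = 0"
          using U T tuple[OF tier2[OF T(1), of U i]]
          by (intro null2[OF _ b, of _ i j]) (auto simp: face2 ones_def)
      qed
    qed auto
    ultimately show ?thesis
      using ones_subset[of "{i}"] by (simp add: Int_absorb2)
  qed
  have split: "Y (zeros T) \<beta> + (\<Sum>i\<in>T. Y (ones {i}) \<beta>) = Y cube01 \<beta>"
    if b: "\<beta> \<in> ?I" and T: "card T \<le> k" for T \<beta>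
  proof -
    \<comment> \<open>Summands with two elements in T - U vanish, so only U = T and the sets U = T -
      {i} remain.\<close>
    let ?f = "\<lambda>U. Y (ones (T - U) \<inter> zeros U) \<beta>" and ?J = "(\<lambda>i. T - {i}) ` T"
    have "(\<Sum>U | U \<subseteq> T. ?f U) = Y cube01 \<beta>"
    proof -
      have "tier_tuple ?C k ([] @ [T]) ([] @ [{}])"
        using tier1[OF T, of "{}"] by simp
      moreover have "tuple_face [] [] = (cube01 :: (real ^ 'n) set)"
        by (simp add: tuple_face_def)
      moreover have "cube01 \<inter> ones A = ones A" for A :: "'n set"
        using ones_subset by (rule Int_absorb1)
      ultimately show ?thesis
        using vi[OF b, unfolded column_vi_def, rule_format,
            where Ws = "[]" and W = T and Ts = "[]" and T = "{}"] T
        by (simp add: column_def Let_def)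
    qed
    moreover have "(\<Sum>U | U \<subseteq> T. ?f U) = (\<Sum>U\<in>insert T ?J. ?f U)"
    proof (rule sum.mono_neutral_right)
      show "\<forall>U\<in>{U. U \<subseteq> T} - insert T ?J. ?f U = 0"
      proof
        fix U assume U: "U \<in> {U. U \<subseteq> T} - insert T ?J"
        then obtain i where i: "i \<in> T - U" by auto
        moreover have "U \<noteq> T - {i}"
          using U i by auto
        ultimately obtain j where "j \<in> T - U" "j \<noteq> i"
          using U by blast
        then show "?f U = 0"
          using U i tuple[OF tier1[OF T, of U]]
          by (intro null2[OF _ b, of _ i j]) (auto simp: face1 ones_def)
      qed
    qed auto
    moreover have "(\<Sum>U\<in>insert T ?J. ?f U) = ?f T + (\<Sum>U\<in>?J. ?f U)"
      by (rule sum.insert) auto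
    moreover have "(\<Sum>U\<in>?J. ?f U) = (\<Sum>i\<in>T. ?f (T - {i}))"
      by (subst sum.reindex) (auto simp: inj_on_def)
    moreover have "(\<Sum>i\<in>T. ?f (T - {i})) = (\<Sum>i\<in>T. Y (ones {i}) \<beta>)"
    proof (rule sum.cong)
      fix i assume i: "i \<in> T"
      have "card (T - {i}) \<le> k"
        using card_mono[of T "T - {i}"] T by simp
      moreover have "T - (T - {i}) = {i}"
        using i by auto
      ultimately show "?f (T - {i}) = Y (ones {i}) \<beta>"
        using drop[OF b, of "T - {i}" i] by simp
    qed simp
    ultimately show ?thesis
      using zeros_subset[of T] by (simp add: Int_absorb1)
  qed
  show "0 \<le> x $ i"
    unfolding x_eq using nonneg[OF vertex cube] .
  show "(\<Sum>i\<in>T1 \<union> T2. x $ i) \<le> 1" if "card T1 \<le> k" "card T2 \<le> k" "T1 \<inter> T2 = {}"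
    unfolding x_eq
    by (rule sum_over_disjoint_le_1[OF sym cons one cube vertex zeros mixed nonneg split drop[OF cube] that])
qed

section \<open>The rank\<close>

text \<open>The levels are not compared with one another: a least good level exists because level
  \<lceil>n/2\<rceil> is good, and the lower bound is tested at that least level itself.\<close>

lemma rank_bounds:
  fixes \<Gamma> :: "nat \<Rightarrow> (real ^ 'n::finite) set"
  assumes n: "3 \<le> CARD('n)"
    and light: "\<And>x k. light_weight x k \<Longrightarrow> 1 \<le> k \<Longrightarrow> x \<in> \<Gamma> k"
    and pos: "\<And>x k i. x \<in> \<Gamma> k \<Longrightarrow> 2 \<le> k \<Longrightarrow> 0 \<le> x $ i"
    and sum: "\<And>x k T1 T2. x \<in> \<Gamma> k \<Longrightarrow> 2 \<le> k \<Longrightarrow> card T1 \<le> k \<Longrightarrow> card T2 \<le> k \<Longrightarrow>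
      T1 \<inter> T2 = {} \<Longrightarrow> (\<Sum>i\<in>T1 \<union> T2. x $ i) \<le> 1"
  shows "\<exists>k. has_rank \<Gamma> (FRAC complete_edges) k \<and>
    \<lceil>real CARD('n) / 2\<rceil> - 2 \<le> int k \<and> int k \<le> \<lceil>(real CARD('n) + 1) / 2\<rceil>"
proof -
  let ?P = "FRAC (complete_edges :: 'n set set)" and ?n = "CARD('n)"
  \<comment> \<open>This is \<lceil>n/2\<rceil>, so that a set of size m and its complement both
    have at most m elements; n at least 3 makes it at least 2.\<close>
  define m where "m = (?n + 1) div 2"
  have m: "2 \<le> m" "?n \<le> 2 * m" "2 * m \<le> ?n + 1"
    using n by (auto simp: m_def)
  have "level \<Gamma> ?P m = integer_hull ?P"
  proof
    show "level \<Gamma> ?P m \<subseteq> integer_hull ?P"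
    proof
      fix x assume "x \<in> level \<Gamma> ?P m"
      then have x: "x \<in> \<Gamma> m"
        using m by (simp add: level_def)
      have "min m ?n \<le> ?n"
        by simp
      then obtain T :: "'n set" where T: "card T = min m ?n"
        by (metis obtain_subset_with_card_n)
      then have "card (- T) \<le> m" "card T \<le> m"
        using m by (auto simp: Compl_eq_Diff_UNIV card_Diff_subset)
      then have "(\<Sum>i\<in>T \<union> - T. x $ i) \<le> 1"
        by (intro sum[OF x m(1)]) auto
      then show "x \<in> integer_hull ?P"
        using pos[OF x m(1)] by (simp add: integer_hull_complete)
    qed
    show "integer_hull ?P \<subseteq> level \<Gamma> ?P m"
    proof
      fix x assume x: "x \<in> integer_hull ?P"
      have "light_weight x m"
      proof
        show "0 \<le> x $ i" for i
          using x by (simp add: integer_hull_complete)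
        fix M :: "'n set"
        have "(\<Sum>i\<in>M. x $ i) \<le> (\<Sum>i\<in>UNIV. x $ i)"
          using x by (intro sum_mono2) (auto simp: integer_hull_complete)
        then show "(\<Sum>i\<in>M. x $ i) \<le> 1"
          using x by (simp add: integer_hull_complete)
      qed
      then show "x \<in> level \<Gamma> ?P m"
        using light m by (simp add: level_def)
    qed
  qed
  then have ex: "\<exists>k. level \<Gamma> ?P k = integer_hull ?P" by blast
  define k where "k = (LEAST k. level \<Gamma> ?P k = integer_hull ?P)"
  have k: "level \<Gamma> ?P k = integer_hull ?P"
    unfolding k_def using ex by (rule LeastI_ex)
  have rank: "has_rank \<Gamma> ?P k"
    unfolding has_rank_def using k not_less_Least by (auto simp: k_def)
  have km: "k \<le> m"
    unfolding k_def by (rule Least_le) fact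
  \<comment> \<open>Level 0 is P itself, outside the reach of \<open>light\<close>. The constant
    vector 1/2 separates it from the hull, since its coordinates add up to n/2 > 1.\<close>
  have "k \<noteq> 0"
  proof
    assume "k = 0"
    moreover have "(\<chi> i. 1 / 2) \<in> ?P"
      by (simp add: FRAC_complete)
    ultimately have "(\<chi> i. 1 / 2) \<in> integer_hull ?P"
      using k by (simp add: level_def)
    then show False
      using n by (simp add: integer_hull_complete)
  qed
  have "?n \<le> 2 * k + 4"
  proof (rule ccontr)
    assume "\<not> ?n \<le> 2 * k + 4"
    then have big: "real ?n > 2 * real k + 4"
      by linarith
    define x :: "real ^ 'n" where "x = (\<chi> i. 1 / (2 * real k + 4))"
    have "light_weight x k"
    proof
      fix M :: "'n set" assume "card M \<le> 2 * k + 4"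
      then have "real (card M) \<le> 2 * real k + 4"
        by linarith
      then show "(\<Sum>i\<in>M. x $ i) \<le> 1"
        by (simp add: x_def)
    qed (simp add: x_def)
    then have "x \<in> integer_hull ?P"
      using light[of x k] k \<open>k \<noteq> 0\<close> by (simp add: level_def)
    then show False
      using big by (simp add: integer_hull_complete x_def)
  qed
  then have "real ?n / 2 \<le> real k + 2"
    by linarith
  then have "\<lceil>real ?n / 2\<rceil> \<le> int k + 2"
    by linarith
  moreover have "int k \<le> \<lceil>(real ?n + 1) / 2\<rceil>"
  proof -
    have "2 * k \<le> ?n + 1"
      using km m(3) by linarith
    then have "real (2 * k) \<le> real (?n + 1)"
      by (simp only: of_nat_le_iff)
    then have "real k \<le> (real ?n + 1) / 2"
      by simp
    then show ?thesis
      by linarith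
  qed
  ultimately show ?thesis
    using rank by (intro exI[of _ k]) simp
qed

theorem theorem8:
  fixes n :: nat and E :: "'n::finite set set"
  assumes "CARD('n) = n" and "n \<ge> 3" and "E = complete_edges"
  shows "(\<exists>k. has_rank (BZ' (FRAC_system E)) (FRAC E) k \<and>
            \<lceil>real n / 2\<rceil> - 2 \<le> int k \<and> int k \<le> \<lceil>(real n + 1) / 2\<rceil>) \<and>
         (\<exists>k. has_rank (BZ (FRAC_system E)) (FRAC E) k \<and>
            \<lceil>real n / 2\<rceil> - 2 \<le> int k \<and> int k \<le> \<lceil>(real n + 1) / 2\<rceil>)"
proof -
  have n: "3 \<le> CARD('n)"
    using assms(1,2) by simp
  then have n2: "2 \<le> CARD('n)"
    by simp
  show ?thesis
    unfolding assms(3) assms(1)[symmetric]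
  proof
    show "\<exists>k. has_rank (BZ' (FRAC_system (complete_edges :: 'n set set))) (FRAC complete_edges) k \<and>
        \<lceil>real CARD('n) / 2\<rceil> - 2 \<le> int k \<and> int k \<le> \<lceil>(real CARD('n) + 1) / 2\<rceil>"
      using light_weight.mem_BZ' sum_coordinates_BZ'[OF _ _ n2] by (intro rank_bounds[OF n])
    show "\<exists>k. has_rank (BZ (FRAC_system (complete_edges :: 'n set set))) (FRAC complete_edges) k \<and>
        \<lceil>real CARD('n) / 2\<rceil> - 2 \<le> int k \<and> int k \<le> \<lceil>(real CARD('n) + 1) / 2\<rceil>"
      using light_weight.mem_BZ sum_coordinates_BZ[OF _ _ n] by (intro rank_bounds[OF n])
  qed
qed

end
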